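(* Let $X,Y$ be infinite-dimensional Hilbert spaces, let $B$, the Hilbert scale $(X_\tau)$, $F$, $f^\dagger$, $u^\dagger$, $\overline{u}$, $a$, $G$, $\varphi$, $\kappa$, $c$, $w$, $\rho$ be as described in the context, and suppose Assumption A and the source condition hold. Fix constants $k,l\in(1,\infty)$ and, for $\delta>0$ and data $f^\delta$ with $\|f^\delta-f^\dagger\|\le\delta$, let $u_{\alpha_\ast}^\delta$ be selected by the discrepancy principle with constants $k,l$. Then $$\|u_{\alpha_\ast}^\delta-u^\dagger\| = \mathrm{O}(\varphi(\delta)) \qquad \text{as } \delta\downarrow 0 .$$
   Context: Let $B:\mathcal{D}(B)\subset X\to X$ be a densely defined, selfadjoint, unbounded linear operator with $\|Bu\|\ge m\|u\|$ for all $u\in\mathcal{D}(B)$, for some constant $m>0$ (so $B$ is strictly positive with bounded inverse). The Hilbert scale: for $\tau>0$, $X_\tau=\mathcal{D}(B^\tau)$ with norm $\|u\|_\tau=\|B^\tau u\|$; for $\tau\le 0$, $X_\tau=X$ with $\|u\|_\tau=\|B^\tau u\|$. Let $F:\mathcal{D}(F)\subset X\to Y$ be a (nonlinear) operator, $u^\dagger\in\mathcal{D}(F)$ with $Fu^\dagger=f^\dagger$, $\overline{u}$ an initial guess. For $\alpha>0$ the Tikhonov functional is $T_\alpha^\delta(u)=\|Fu-f^\delta\|^2+\alpha\|u-\overline{u}\|_1^2$ (equal to $+\infty$ if $u\notin X_1$), and $u_\alpha^\delta$ denotes a minimizer of $T_\alpha^\delta$ over $\mathcal{D}(F)$. Assumption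 A: (a) $F$ is sequentially continuous on $\mathcal{D}(F)$ w.r.t. the weak topologies of $X$ and $Y$; (b) $\mathcal{D}(F)$ is closed and convex in $X$; (c) $\mathcal{D}:=\mathcal{D}(F)\cap X_1\neq\emptyset$ and $\overline{u}\in\mathcal{D}$; (d) $u^\dagger$ is an interior point of $\mathcal{D}(F)$; (e) $\|f^\delta-f^\dagger\|\le\delta$; (f) there are $a>0$ and constants $0<c_a\le C_a<\infty$ with $c_a\|u-u^\dagger\|_{-a}\le\|Fu-f^\dagger\|\le C_a\|u-u^\dagger\|_{-a}$ for all $u\in\mathcal{D}$. Source condition: with $a$ from (f), $G:=B^{-(2a+2)}$ (bounded, injective, selfadjoint, positive semidefinite); $\kappa>0$, $c\in(0,\|G\|^{-1})$, $\varphi:(0,\|G\|]\to(0,\infty)$, $\varphi(t)=(-\ln(ct))^{-\kappa}$; and $u^\dagger-\overline{u}=\varphi(G)w$ for some $w\in X$ with $\|w\|\le\rho$, $\rho>0$. Discrepancy principle (constants $k,l>1$): (a) if $\|F\overline{u}-f^\delta\|\le k\delta$, set $u_{\alpha_\ast}^\delta:=\overline{u}$ ($\alpha_\ast=\infty$); (b) if $\|F\overline{u}-f^\delta\|>k\delta$, choose $\alpha_\ast\in(0,\infty)$ such that $\|Fu_{\alpha_\ast}^\delta-f^\delta\|\le k\delta\le\|Fu_{\gamma_\ast}^\delta-f^\delta\|$ for some $\gamma_\ast\in[\alpha_\ast,l\alpha_\ast]$. *)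

theory Defs
  imports "HOL-Analysis.Analysis"
begin

definition infinite_dimensional :: "'a::real_vector itself \<Rightarrow> bool" where
  "infinite_dimensional _ \<longleftrightarrow> \<not> (\<exists>S::'a set. finite S \<and> span S = UNIV)"

definition weakly_conv :: "(nat \<Rightarrow> 'a::real_inner) \<Rightarrow> 'a \<Rightarrow> bool" where
  "weakly_conv s u \<longleftrightarrow> (\<forall>z. (\<lambda>n. inner (s n) z) \<longlonglongrightarrow> inner u z)"

definition adjoint_dom :: "'a set \<Rightarrow> ('a \<Rightarrow> 'a) \<Rightarrow> 'a::real_inner set" where
  "adjoint_dom D T = {v. \<exists>z. \<forall>u\<in>D. inner (T u) v = inner u z}"

definition selfadjoint_op :: "'a::real_inner set \<Rightarrow> ('a \<Rightarrow> 'a) \<Rightarrow> bool" where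
  "selfadjoint_op D T \<longleftrightarrow>
     subspace D \<and> (\<forall>u\<in>D. \<forall>v\<in>D. \<forall>s t. T (s *\<^sub>R u + t *\<^sub>R v) = s *\<^sub>R T u + t *\<^sub>R T v)
     \<and> closure D = UNIV
     \<and> (\<forall>u\<in>D. \<forall>v\<in>D. inner (T u) v = inner u (T v))
     \<and> adjoint_dom D T = D"

definition spectral_measure :: "(real set \<Rightarrow> 'a \<Rightarrow> 'a::real_inner) \<Rightarrow> bool" where
  "spectral_measure E \<longleftrightarrow>
     (\<forall>A\<in>sets borel. bounded_linear (E A) \<and> E A \<circ> E A = E A
                     \<and> (\<forall>x y. inner (E A x) y = inner x (E A y)))
     \<and> E {} = (\<lambda>x. 0) \<and> E UNIV = id
     \<and> (\<forall>A\<in>sets borel. \<forall>B\<in>sets borel. E (A \<inter> B) = E A \<circ> E B)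
     \<and> (\<forall>Af x. range Af \<subseteq> sets borel \<longrightarrow> disjoint_family Af \<longrightarrow>
          (\<lambda>n. E (\<Union>i<n. Af i) x) \<longlonglongrightarrow> E (\<Union>i. Af i) x)"

definition spec_meas :: "(real set \<Rightarrow> 'a \<Rightarrow> 'a::real_inner) \<Rightarrow> 'a \<Rightarrow> real measure" where
  "spec_meas E x = measure_of UNIV (sets borel) (\<lambda>A. ennreal ((norm (E A x))\<^sup>2))"

definition fc_dom :: "(real set \<Rightarrow> 'a \<Rightarrow> 'a::real_inner) \<Rightarrow> (real \<Rightarrow> real) \<Rightarrow> 'a set" where
  "fc_dom E g = {x. integrable (spec_meas E x) (\<lambda>t. (g t)\<^sup>2)}"

text \<open>y = g(E) x, characterised weakly: <y,z> = \<integral> g d<E x, z> (polarisation).\<close>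
definition fc_rel :: "(real set \<Rightarrow> 'a \<Rightarrow> 'a::real_inner) \<Rightarrow> (real \<Rightarrow> real) \<Rightarrow> 'a \<Rightarrow> 'a \<Rightarrow> bool" where
  "fc_rel E g x y \<longleftrightarrow> x \<in> fc_dom E g \<and>
     (\<forall>z\<in>fc_dom E g. inner y z =
        ((\<integral>t. g t \<partial>spec_meas E (x + z)) - (\<integral>t. g t \<partial>spec_meas E (x - z))) / 4)"

definition fc :: "(real set \<Rightarrow> 'a \<Rightarrow> 'a::real_inner) \<Rightarrow> (real \<Rightarrow> real) \<Rightarrow> 'a \<Rightarrow> 'a" where
  "fc E g x = (THE y. fc_rel E g x y)"

definition spectral_resolution_of :: "(real set \<Rightarrow> 'a \<Rightarrow> 'a::real_inner) \<Rightarrow> 'a set \<Rightarrow> ('a \<Rightarrow> 'a) \<Rightarrow> bool" where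
  "spectral_resolution_of E D T \<longleftrightarrow> spectral_measure E \<and> D = fc_dom E (\<lambda>t. t)
     \<and> (\<forall>u\<in>D. fc_rel E (\<lambda>t. t) u (T u))"

definition Bpow :: "(real set \<Rightarrow> 'a \<Rightarrow> 'a::real_inner) \<Rightarrow> real \<Rightarrow> 'a \<Rightarrow> 'a" where
  "Bpow E \<tau> = fc E (\<lambda>t. t powr \<tau>)"

definition hscale :: "(real set \<Rightarrow> 'a \<Rightarrow> 'a::real_inner) \<Rightarrow> real \<Rightarrow> 'a set" where
  "hscale E \<tau> = (if \<tau> > 0 then fc_dom E (\<lambda>t. t powr \<tau>) else UNIV)"

definition hnorm :: "(real set \<Rightarrow> 'a \<Rightarrow> 'a::real_inner) \<Rightarrow> real \<Rightarrow> 'a \<Rightarrow> real" where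
  "hnorm E \<tau> u = norm (Bpow E \<tau> u)"

definition tikhonov ::
  "(real set \<Rightarrow> 'a \<Rightarrow> 'a::real_inner) \<Rightarrow> ('a \<Rightarrow> 'b::real_normed_vector) \<Rightarrow> 'a \<Rightarrow> 'b \<Rightarrow> real \<Rightarrow> 'a \<Rightarrow> ereal" where
  "tikhonov E F ubar fd \<alpha> u =
     (if u \<in> hscale E 1 then ereal ((norm (F u - fd))\<^sup>2 + \<alpha> * (hnorm E 1 (u - ubar))\<^sup>2) else \<infinity>)"

definition tikhonov_minimizer ::
  "(real set \<Rightarrow> 'a \<Rightarrow> 'a::real_inner) \<Rightarrow> 'a set \<Rightarrow> ('a \<Rightarrow> 'b::real_normed_vector) \<Rightarrow> 'a \<Rightarrow> 'b \<Rightarrow> real \<Rightarrow> 'a \<Rightarrow> bool" where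
  "tikhonov_minimizer E DF F ubar fd \<alpha> u \<longleftrightarrow>
     u \<in> DF \<and> (\<forall>v\<in>DF. tikhonov E F ubar fd \<alpha> u \<le> tikhonov E F ubar fd \<alpha> v)"

definition discrepancy_selected ::
  "(real set \<Rightarrow> 'a \<Rightarrow> 'a::real_inner) \<Rightarrow> 'a set \<Rightarrow> ('a \<Rightarrow> 'b::real_normed_vector) \<Rightarrow> 'a \<Rightarrow> real \<Rightarrow> real
     \<Rightarrow> real \<Rightarrow> 'b \<Rightarrow> 'a \<Rightarrow> bool" where
  "discrepancy_selected E DF F ubar k l \<delta> fd u \<longleftrightarrow>
     (norm (F ubar - fd) \<le> k * \<delta> \<and> u = ubar)
     \<or> (norm (F ubar - fd) > k * \<delta> \<and>
        (\<exists>\<alpha>>0. tikhonov_minimizer E DF F ubar fd \<alpha> u \<and> norm (F u - fd) \<le> k * \<delta> \<and>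
           (\<exists>\<gamma> v. \<alpha> \<le> \<gamma> \<and> \<gamma> \<le> l * \<alpha> \<and> tikhonov_minimizer E DF F ubar fd \<gamma> v
                   \<and> k * \<delta> \<le> norm (F v - fd))))"

end

theory Submission
  imports Defs "HOL-Real_Asymp.Real_Asymp"
begin

text \<open>
  Put \<open>b = 2a + 2\<close> and cut \<open>p = u\<^sup>\<dagger> - u\<^sub>0\<close> off spectrally at \<open>\<bar>B\<bar> \<le> R\<close>, giving \<open>v = u\<^sub>0 + q\<close>. The source condition yields
  \<open>\<parallel>v - u\<^sup>\<dagger>\<parallel> \<le> \<rho> \<phi>(R\<^sup>-\<^sup>b)\<close>, \<open>\<parallel>v - u\<^sup>\<dagger>\<parallel>\<^sub>-\<^sub>a \<le> \<rho> R\<^sup>-\<^sup>a \<phi>(R\<^sup>-\<^sup>b)\<close> and \<open>\<parallel>q\<parallel>\<^sub>1 \<le> C \<rho> R \<phi>(R\<^sup>-\<^sup>b)\<close>.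
  Choose \<open>R\<^sup>a = K \<phi>(\<delta>) / \<delta>\<close>; then \<open>R\<^sup>-\<^sup>b \<le> \<delta>\<close> for small \<open>\<delta>\<close>, and for a suitable \<open>K\<close> the residual of \<open>v\<close>
  is at most \<open>(k + 1) \<delta> / 2\<close>. Comparing the Tikhonov functional at the minimizer for \<open>\<gamma>\<^sub>*\<close> with its value at
  \<open>v\<close> bounds \<open>\<alpha>\<^sub>*\<close> from below, and comparing at \<open>u\<close> then gives \<open>\<parallel>u - u\<^sub>0\<parallel>\<^sub>1 = O(\<parallel>q\<parallel>\<^sub>1)\<close>. Since
  \<open>\<parallel>x\<parallel>\<^sup>2 \<le> R\<^sup>2\<^sup>a \<parallel>x\<parallel>\<^sub>-\<^sub>a\<^sup>2 + R\<^sup>-\<^sup>2 \<parallel>x\<parallel>\<^sub>1\<^sup>2\<close>, taking \<open>x = u - v\<close> yields \<open>\<parallel>u - v\<parallel> = O(\<phi>(\<delta>))\<close>.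

  The spectral measures of \<open>B\<close> and \<open>G = B\<^sup>-\<^sup>b\<close> are given separately; that the latter is the image of the
  former follows from equality of all moments and the Weierstrass approximation theorem.
\<close>

subsection \<open>Finite additivity and the scalar spectral measures\<close>

lemma sets_spec_meas [simp, measurable_cong]: "sets (spec_meas E x) = sets borel"
  and space_spec_meas [simp]: "space (spec_meas E x) = UNIV"
  using sets.sigma_sets_eq[of "borel :: real measure"]
  by (simp_all add: spec_meas_def)

lemma
  assumes "spectral_measure E"
  shows spectral_measure_bounded_linear: "A \<in> sets borel \<Longrightarrow> bounded_linear (E A)"
    and spectral_measure_sym: "A \<in> sets borel \<Longrightarrow> inner (E A x) y = inner x (E A y)"
    and spectral_measure_Int: "A \<in> sets borel \<Longrightarrow> B \<in> sets borel \<Longrightarrow> E A (E B x) = E (A \<inter> B) x"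
    and spectral_measure_empty: "E {} x = 0"
    and spectral_measure_UNIV: "E UNIV x = x"
    and spectral_measure_LIMSEQ: "range Af \<subseteq> sets borel \<Longrightarrow> disjoint_family Af \<Longrightarrow>
      (\<lambda>n. E (\<Union>i<n. Af i) x) \<longlonglongrightarrow> E (\<Union>i. Af i) x"
  using assms unfolding spectral_measure_def by (auto simp: fun_eq_iff)

lemma spectral_measure_norm_sq:
  assumes "spectral_measure E" "A \<in> sets borel"
  shows "(norm (E A x))\<^sup>2 = inner (E A x) x"
  using assms by (simp add: power2_norm_eq_inner spectral_measure_sym spectral_measure_Int)

text \<open>\<^const>\<open>spectral_measure\<close> does not contain finite additivity. Where it fails,
  \<^const>\<open>measure_of\<close> yields the null measure.\<close>

lemma spec_meas_eq_null_measure: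
  assumes E: "spectral_measure E" and AB: "A \<in> sets borel" "B \<in> sets borel" "A \<inter> B = {}"
    and neq: "E (A \<union> B) y \<noteq> E A y + E B y"
  shows "spec_meas E y = null_measure borel"
proof -
  let ?\<mu> = "\<lambda>A. ennreal ((norm (E A y))\<^sup>2)"
  have "\<not> measure_space UNIV (sets borel) ?\<mu>"
  proof
    assume "measure_space UNIV (sets borel) ?\<mu>"
    then have "positive (sets borel) ?\<mu>" "countably_additive (sets borel) ?\<mu>"
      "sigma_algebra UNIV (sets (borel :: real measure))"
      by (auto simp: measure_space_def)
    then have "additive (sets borel) ?\<mu>"
      by (metis ring_of_sets.countably_additive_additive sigma_algebra.axioms(1) algebra.axioms(1))
    then have "?\<mu> (A \<union> B) = ?\<mu> A + ?\<mu> B"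
      using AB by (auto simp: additive_def)
    then have sum: "(norm (E (A \<union> B) y))\<^sup>2 = (norm (E A y))\<^sup>2 + (norm (E B y))\<^sup>2"
      by (simp flip: ennreal_plus)
    have i1: "inner (E (A \<union> B) y) (E A y) = (norm (E A y))\<^sup>2"
      and i2: "inner (E (A \<union> B) y) (E B y) = (norm (E B y))\<^sup>2"
      and i3: "inner (E A y) (E B y) = 0"
      using AB by (simp_all add: spectral_measure_norm_sq[OF E] spectral_measure_sym[OF E]
          spectral_measure_Int[OF E] spectral_measure_empty[OF E] Int_absorb1 Un_Int_eq)
    have "(norm (E (A \<union> B) y - (E A y + E B y)))\<^sup>2 = 0"
      using i1 i2 i3 sum
      by (simp add: power2_norm_eq_inner inner_simps inner_commute)
    with neq show False by simp
  qed
  then show ?thesis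
    by (intro measure_eqI)
      (auto simp: spec_meas_def emeasure_measure_of_conv sets.sigma_sets_eq[of "borel :: real measure", simplified])
qed

text \<open>Finite additivity is a separate assumption, since it is what makes
  \<open>spec_meas\<close> a genuine measure. For the resolution of \<open>B\<close> it comes from
  selfadjointness and unboundedness, for that of \<open>G\<close> from definiteness.\<close>

locale projection_valued_measure =
  fixes E :: "real set \<Rightarrow> 'x \<Rightarrow> 'x::{real_inner, complete_space}"
  assumes spectral: "spectral_measure E"
    and E_Un: "A \<in> sets borel \<Longrightarrow> B \<in> sets borel \<Longrightarrow> A \<inter> B = {} \<Longrightarrow> E (A \<union> B) x = E A x + E B x"
begin

lemmas E_bounded_linear = spectral_measure_bounded_linear[OF spectral]
  and E_sym = spectral_measure_sym[OF spectral]
  and E_Int = spectral_measure_Int[OF spectral]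
  and E_empty = spectral_measure_empty[OF spectral]
  and E_UNIV = spectral_measure_UNIV[OF spectral]
  and E_norm_sq = spectral_measure_norm_sq[OF spectral]

lemmas E_linear = E_bounded_linear[THEN bounded_linear.linear]

text \<open>Projections of disjoint sets have product \<open>E {} = 0\<close>, hence orthogonal
  ranges, and Pythagoras applies.\<close>

lemma E_UN_lessThan_norm_sq:
  fixes Af :: "nat \<Rightarrow> real set"
  assumes "range Af \<subseteq> sets borel" "disjoint_family Af"
  shows "(norm (E (\<Union>i<n. Af i) x))\<^sup>2 = (\<Sum>i<n. (norm (E (Af i) x))\<^sup>2)"
proof (induction n)
  case 0
  show ?case by (simp add: E_empty)
next
  case (Suc n)
  have disj: "(\<Union>i<n. Af i) \<inter> Af n = {}"
  proof -
    have "Af i \<inter> Af n = {}" if "i < n" for i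
      using assms(2) that by (auto simp: disjoint_family_on_def)
    then show ?thesis by blast
  qed
  have meas: "(\<Union>i<n. Af i) \<in> sets borel" "Af n \<in> sets borel" using assms(1) by auto
  have "E ((\<Union>i<n. Af i) \<union> Af n) x = E (\<Union>i<n. Af i) x + E (Af n) x"
    using disj meas by (intro E_Un)
  moreover have "inner (E (\<Union>i<n. Af i) x) (E (Af n) x) = 0"
    using meas disj by (simp add: E_sym E_Int E_empty)
  ultimately show ?case
    using Suc by (simp add: lessThan_Suc Un_commute norm_add_Pythagorean orthogonal_def)
qed

text \<open>Strong convergence of \<open>E\<close> along disjoint unions, combined with Pythagoras,
  gives countable additivity, so \<open>measure_of\<close> returns the intended set function and not
  its default 0.\<close>

lemma emeasure_spec_meas:
  assumes "A \<in> sets borel"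
  shows "emeasure (spec_meas E x) A = ennreal ((norm (E A x))\<^sup>2)"
proof (rule emeasure_measure_of[OF spec_meas_def])
  show "positive (sets (spec_meas E x)) (\<lambda>A. ennreal ((norm (E A x))\<^sup>2))"
    by (simp add: positive_def E_empty)
  show "countably_additive (sets (spec_meas E x)) (\<lambda>A. ennreal ((norm (E A x))\<^sup>2))"
  proof (rule countably_additiveI)
    fix Af :: "nat \<Rightarrow> real set"
    assume Af: "range Af \<subseteq> sets (spec_meas E x)" "disjoint_family Af"
    then have "(\<lambda>n. (norm (E (\<Union>i<n. Af i) x))\<^sup>2) \<longlonglongrightarrow> (norm (E (\<Union>i. Af i) x))\<^sup>2"
      by (intro tendsto_intros spectral_measure_LIMSEQ[OF spectral]) auto
    then have "(\<lambda>i. (norm (E (Af i) x))\<^sup>2) sums (norm (E (\<Union>i. Af i) x))\<^sup>2"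
      using Af by (simp add: sums_def E_UN_lessThan_norm_sq)
    then show "(\<Sum>i. ennreal ((norm (E (Af i) x))\<^sup>2)) = ennreal ((norm (E (\<Union>i. Af i) x))\<^sup>2)"
      by (intro suminf_ennreal_eq) auto
  qed
qed (use assms in auto)

lemma measure_spec_meas:
  assumes "A \<in> sets borel"
  shows "measure (spec_meas E x) A = (norm (E A x))\<^sup>2"
  using assms by (simp add: measure_def emeasure_spec_meas)

lemma emeasure_spec_meas_UNIV: "emeasure (spec_meas E x) UNIV = ennreal ((norm x)\<^sup>2)"
  by (simp add: emeasure_spec_meas E_UNIV)

lemma finite_measure_spec_meas: "finite_measure (spec_meas E x)"
  by (rule finite_measureI) (simp add: emeasure_spec_meas)

text \<open>Polarisation of the quadratic form \<open>inner (E A x) x\<close>. It links the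
  projections to the difference of integrals by which \<open>fc_rel\<close> is defined.\<close>

lemma spec_meas_polarization:
  assumes "A \<in> sets borel"
  shows "inner (E A x) z = (measure (spec_meas E (x + z)) A - measure (spec_meas E (x - z)) A) / 4"
proof -
  have "inner (E A z) x = inner (E A x) z"
    using assms by (simp add: E_sym inner_commute[of z])
  then show ?thesis
    unfolding measure_spec_meas[OF assms] E_norm_sq[OF assms]
    using assms by (simp add: linear_add[OF E_linear] linear_diff[OF E_linear] inner_add_left inner_add_right inner_diff_left inner_diff_right)
qed

lemma spec_meas_E:
  assumes [measurable]: "C \<in> sets borel"
  shows "spec_meas E (E C x) = density (spec_meas E x) (indicator C)"
proof (rule measure_eqI)
  fix A assume "A \<in> sets (spec_meas E (E C x))"
  then have [measurable]: "A \<in> sets borel" by simp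
  show "emeasure (spec_meas E (E C x)) A = emeasure (density (spec_meas E x) (indicator C)) A"
    by (simp add: emeasure_density emeasure_spec_meas E_Int Int_commute flip: indicator_inter_arith)
qed simp

text \<open>The bound \<open>(s + t)^2 \<le> 2 s^2 + 2 t^2\<close> on indicators extends to all
  nonnegative Borel functions by monotone induction. It makes \<open>fc_dom\<close> closed under
  sums and serves as triangle inequality for the scale norms.\<close>

lemma nn_integral_spec_meas_add_le:
  assumes "f \<in> borel_measurable borel"
  shows "(\<integral>\<^sup>+t. f t \<partial>spec_meas E (x + y))
           \<le> 2 * (\<integral>\<^sup>+t. f t \<partial>spec_meas E x) + 2 * (\<integral>\<^sup>+t. f t \<partial>spec_meas E y)"
  using assms
proof (induction rule: borel_measurable_induct)
  case (cong f g)
  then have "f = g" by auto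
  with cong show ?case by simp
next
  case (set A)
  have "norm (E A (x + y)) \<le> norm (E A x) + norm (E A y)"
    using linear_add[OF E_linear[OF set]] norm_triangle_ineq by metis
  then have "(norm (E A (x + y)))\<^sup>2 \<le> (norm (E A x) + norm (E A y))\<^sup>2"
    by (intro power_mono) auto
  also have "\<dots> \<le> 2 * (norm (E A x))\<^sup>2 + 2 * (norm (E A y))\<^sup>2"
    using sum_squares_bound[of "norm (E A x)" "norm (E A y)"] by (simp add: power2_sum)
  finally have "ennreal ((norm (E A (x + y)))\<^sup>2)
      \<le> ennreal (2 * (norm (E A x))\<^sup>2 + 2 * (norm (E A y))\<^sup>2)"
    by (rule ennreal_leI)
  with set show ?case
    by (simp add: emeasure_spec_meas ennreal_mult)
next
  case (mult u c)
  then show ?case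
    using mult_left_mono[OF mult.IH, of c]
    by (simp add: nn_integral_cmult distrib_left mult.left_commute)
next
  case (add u v)
  then show ?case
    using add_mono[OF add.IH]
    by (simp add: nn_integral_add distrib_left add_ac)
next
  case (seq U)
  have eq: "(\<integral>\<^sup>+t. (SUP i. U i) t \<partial>spec_meas E z) = (SUP i. \<integral>\<^sup>+t. U i t \<partial>spec_meas E z)" for z
    unfolding SUP_apply by (rule nn_integral_monotone_convergence_SUP) (use seq in auto)
  show ?case
    unfolding eq
  proof (rule SUP_least)
    fix i
    note seq.IH[of i]
    also have "2 * (\<integral>\<^sup>+t. U i t \<partial>spec_meas E x) + 2 * (\<integral>\<^sup>+t. U i t \<partial>spec_meas E y)
       \<le> 2 * (SUP i. \<integral>\<^sup>+t. U i t \<partial>spec_meas E x) + 2 * (SUP i. \<integral>\<^sup>+t. U i t \<partial>spec_meas E y)"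
      by (intro add_mono mult_left_mono SUP_upper) auto
    finally show "(\<integral>\<^sup>+t. U i t \<partial>spec_meas E (x + y)) \<le> \<dots>" .
  qed
qed

end

subsection \<open>Functional calculus\<close>

context projection_valued_measure
begin

definition simple_fc :: "(real \<Rightarrow> real) \<Rightarrow> 'x \<Rightarrow> 'x" where
  "simple_fc s x = (\<Sum>v\<in>range s. v *\<^sub>R E (s -` {v}) x)"

lemma simple_function_borel_vimage:
  "simple_function borel (s :: real \<Rightarrow> real) \<Longrightarrow> s -` {v} \<in> sets borel"
  using simple_functionD(2)[of borel s "{v}"] by simp

lemma integrable_spec_meas_bounded:
  fixes f :: "real \<Rightarrow> real"
  assumes "f \<in> borel_measurable borel" "\<And>t. \<bar>f t\<bar> \<le> M"
  shows "integrable (spec_meas E x) f"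
  using finite_measure_spec_meas assms
  by (intro finite_measure.integrable_const_bound[where B = M]) auto

text \<open>Polarisation on each level set. For \<open>C = UNIV\<close> this is the identity
  demanded by \<open>fc_rel\<close>, with a simple function in place of \<open>g\<close>.\<close>

lemma inner_simple_fc:
  assumes s: "simple_function borel s" and C: "C \<in> sets borel"
  shows "inner (E C (simple_fc s x)) z =
    ((\<integral>t. indicator C t * s t \<partial>spec_meas E (x + z)) - (\<integral>t. indicator C t * s t \<partial>spec_meas E (x - z))) / 4"
proof -
  have fin: "finite (range s)" using simple_functionD(1)[OF s] by simp
  note meas = simple_function_borel_vimage[OF s]
  have int: "(\<integral>t. indicator C t * s t \<partial>spec_meas E y) = (\<Sum>v\<in>range s. v * measure (spec_meas E y) (C \<inter> s -` {v}))" for y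
  proof -
    have "indicator C t * s t = (\<Sum>v\<in>range s. v * indicator (C \<inter> s -` {v}) t)" for t
    proof -
      have "(\<Sum>v\<in>range s. v * indicator (C \<inter> s -` {v}) t) = (\<Sum>v\<in>range s. if v = s t then v * indicator C t else 0)"
        by (intro sum.cong) (auto simp: indicator_def)
      then show ?thesis using fin by simp
    qed
    moreover have "integrable (spec_meas E y) (\<lambda>t. v * indicator (C \<inter> s -` {v}) t)" for v
      by (rule integrable_spec_meas_bounded[where M = "\<bar>v\<bar>"],
          intro borel_measurable_times borel_measurable_const borel_measurable_indicator sets.Int C meas)
        (simp add: abs_mult indicator_def)
    ultimately show ?thesis
      using C meas by (simp add: Bochner_Integration.integral_sum)
  qed
  have "inner (E C (simple_fc s x)) z = (\<Sum>v\<in>range s. v * inner (E (C \<inter> s -` {v}) x) z)"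
    using C meas
    by (simp add: simple_fc_def linear_sum[OF E_linear] linear_cmul[OF E_linear] inner_sum_left E_Int)
  also have "\<dots> = (\<Sum>v\<in>range s. (v * measure (spec_meas E (x + z)) (C \<inter> s -` {v})
      - v * measure (spec_meas E (x - z)) (C \<inter> s -` {v})) / 4)"
    using C meas by (intro sum.cong) (auto simp: spec_meas_polarization field_simps)
  finally show ?thesis
    by (simp add: int sum_subtractf flip: sum_divide_distrib)
qed

text \<open>Projections of level sets multiply like intersections. \<open>C = UNIV\<close> gives the
  isometry into L^2 behind the Cauchy argument below; general \<open>C\<close> identifies the
  spectral measure of the limit.\<close>

lemma inner_simple_fc_simple_fc:
  assumes s: "simple_function borel s" and s': "simple_function borel s'" and C: "C \<in> sets borel"
  shows "inner (E C (simple_fc s x)) (simple_fc s' x) = (\<integral>t. indicator C t * (s t * s' t) \<partial>spec_meas E x)"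
proof -
  have fin: "finite (range s)" "finite (range s')"
    using simple_functionD(1)[OF s] simple_functionD(1)[OF s'] by simp_all
  note meas = simple_function_borel_vimage[OF s] simple_function_borel_vimage[OF s']
  let ?S = "\<lambda>v v'. C \<inter> s -` {v} \<inter> s' -` {v'}"
  have "indicator C t * (s t * s' t) = (\<Sum>v\<in>range s. \<Sum>v'\<in>range s'. v * v' * indicator (?S v v') t)" for t
  proof -
    have "(\<Sum>v\<in>range s. \<Sum>v'\<in>range s'. v * v' * indicator (?S v v') t)
      = (\<Sum>v\<in>range s. \<Sum>v'\<in>range s'. if v' = s' t then (if v = s t then v * v' * indicator C t else 0) else 0)"
      by (intro sum.cong) (auto simp: indicator_def)
    also have "\<dots> = (\<Sum>v\<in>range s. (if v = s t then v * s' t * indicator C t else 0))"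
      using fin by (intro sum.cong) auto
    finally show ?thesis using fin by simp
  qed
  moreover have "integrable (spec_meas E x) (\<lambda>t. v * v' * indicator (?S v v') t)" for v v'
    by (rule integrable_spec_meas_bounded[where M = "\<bar>v * v'\<bar>"],
        intro borel_measurable_times borel_measurable_const borel_measurable_indicator sets.Int C meas)
      (simp add: abs_mult indicator_def)
  ultimately have "(\<integral>t. indicator C t * (s t * s' t) \<partial>spec_meas E x)
      = (\<Sum>v\<in>range s. \<Sum>v'\<in>range s'. v * v' * measure (spec_meas E x) (?S v v'))"
    using C meas by (simp add: Bochner_Integration.integral_sum)
  also have "\<dots> = (\<Sum>v\<in>range s. \<Sum>v'\<in>range s'. v * v' * inner (E (C \<inter> s -` {v}) x) (E (s' -` {v'}) x))"
  proof (intro sum.cong refl)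
    fix v v'
    have "measure (spec_meas E x) (?S v v') = inner (E (?S v v') x) x"
      using C meas by (simp add: measure_spec_meas E_norm_sq)
    also have "\<dots> = inner (E (C \<inter> s -` {v}) x) (E (s' -` {v'}) x)"
      using C meas by (simp add: E_sym[of "s' -` {v'}", symmetric] E_Int Int_ac)
    finally show "v * v' * measure (spec_meas E x) (?S v v')
      = v * v' * inner (E (C \<inter> s -` {v}) x) (E (s' -` {v'}) x)" by simp
  qed
  also have "\<dots> = inner (E C (simple_fc s x)) (simple_fc s' x)"
    using C meas
    by (simp add: simple_fc_def linear_sum[OF E_linear] linear_cmul[OF E_linear] inner_sum_left
        inner_sum_right E_Int mult.assoc sum_distrib_left)
       (subst sum.swap, simp add: mult_ac)
  finally show ?thesis by simp
qed

lemma fc_dom_iff_nn_integral: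
  assumes "g \<in> borel_measurable borel"
  shows "x \<in> fc_dom E g \<longleftrightarrow> (\<integral>\<^sup>+t. ennreal ((g t)\<^sup>2) \<partial>spec_meas E x) < \<infinity>"
  using assms by (simp add: fc_dom_def integrable_iff_bounded)

lemma fc_dom_add:
  assumes [measurable]: "g \<in> borel_measurable borel" and "x \<in> fc_dom E g" "y \<in> fc_dom E g"
  shows "x + y \<in> fc_dom E g"
proof -
  have "(\<integral>\<^sup>+t. ennreal ((g t)\<^sup>2) \<partial>spec_meas E (x + y)) < \<infinity>"
    by (rule le_less_trans[OF nn_integral_spec_meas_add_le])
       (use assms in \<open>simp_all add: fc_dom_iff_nn_integral ennreal_mult_less_top\<close>)
  then show ?thesis by (simp add: fc_dom_iff_nn_integral)
qed

lemma spec_meas_uminus: "spec_meas E (- x) = spec_meas E x"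
  by (rule measure_eqI) (auto simp: emeasure_spec_meas linear_neg[OF E_linear])

lemma fc_dom_uminus: "x \<in> fc_dom E g \<Longrightarrow> - x \<in> fc_dom E g"
  by (simp add: fc_dom_def spec_meas_uminus)

lemma fc_dom_diff:
  assumes "g \<in> borel_measurable borel" and "x \<in> fc_dom E g" "y \<in> fc_dom E g"
  shows "x - y \<in> fc_dom E g"
  using fc_dom_add[OF assms(1,2) fc_dom_uminus[OF assms(3)]] by simp

lemma integrable_fc_dom:
  assumes "g \<in> borel_measurable borel" "x \<in> fc_dom E g"
  shows "integrable (spec_meas E x) g"
proof -
  interpret finite_measure "spec_meas E x" by (rule finite_measure_spec_meas)
  show ?thesis
    by (rule square_integrable_imp_integrable) (use assms in \<open>simp_all add: fc_dom_def\<close>)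
qed

text \<open>The vector is the limit of the simple-function values: by the L^2 isometry they form a
  Cauchy sequence, and completeness applies. The weak identity and the density formula both pass to
  the limit by dominated convergence.\<close>

lemma fc_rel_exists:
  assumes g [measurable]: "g \<in> borel_measurable borel" and x: "x \<in> fc_dom E g"
  shows "\<exists>y. fc_rel E g x y \<and> spec_meas E y = density (spec_meas E x) (\<lambda>t. ennreal ((g t)\<^sup>2))"
proof -
  \<comment> \<open>The simple functions stay below \<open>2 * \<bar>g\<bar>\<close>, so multiples
    of \<open>\<bar>g\<bar>\<close> and of its square dominate all limits taken here.\<close>
  obtain s where s: "\<And>i. simple_function borel (s i)" and lim: "\<And>t. (\<lambda>i. s i t) \<longlonglongrightarrow> g t"
    and bd: "\<And>i t. \<bar>s i t\<bar> \<le> 2 * \<bar>g t\<bar>"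
    using borel_measurable_implies_sequence_metric[OF g, of 0] by (auto simp: dist_real_def)
  have [measurable]: "s i \<in> borel_measurable borel" for i
    using s by (rule borel_measurable_simple_function)
  have ig: "integrable (spec_meas E x) (\<lambda>t. (g t)\<^sup>2)"
    using x by (simp add: fc_dom_def)
  have bd2: "\<bar>s i t * s j t\<bar> \<le> 4 * (g t)\<^sup>2" for i j t
    using mult_mono[OF bd[of i t] bd[of j t]] by (simp add: abs_mult power2_eq_square)
  have int_ss: "integrable (spec_meas E x) (\<lambda>t. s i t * s j t)" for i j
    by (rule Bochner_Integration.integrable_bound[where f = "\<lambda>t. 4 * (g t)\<^sup>2"])
       (use ig bd2 in auto)
  have bd3: "(s i t - g t)\<^sup>2 \<le> 9 * (g t)\<^sup>2" for i t
  proof -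
    have "\<bar>s i t - g t\<bar> \<le> 3 * \<bar>g t\<bar>" using bd[of i t] by linarith
    then have "\<bar>s i t - g t\<bar>\<^sup>2 \<le> (3 * \<bar>g t\<bar>)\<^sup>2" by (intro power_mono) auto
    then show ?thesis by (simp add: power_mult_distrib)
  qed
  have int_sg: "integrable (spec_meas E x) (\<lambda>t. (s i t - g t)\<^sup>2)" for i
    by (rule Bochner_Integration.integrable_bound[where f = "\<lambda>t. 9 * (g t)\<^sup>2"])
       (use ig bd3 in auto)
  define e where "e i = (\<integral>t. (s i t - g t)\<^sup>2 \<partial>spec_meas E x)" for i
  have "(\<lambda>i. \<integral>t. (s i t - g t)\<^sup>2 \<partial>spec_meas E x) \<longlonglongrightarrow> (\<integral>t. 0 \<partial>spec_meas E x)"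
  proof (rule integral_dominated_convergence[where w = "\<lambda>t. 9 * (g t)\<^sup>2"])
    show "AE t in spec_meas E x. (\<lambda>i. (s i t - g t)\<^sup>2) \<longlonglongrightarrow> 0"
    proof (rule AE_I2)
      fix t
      have "(\<lambda>i. (s i t - g t)\<^sup>2) \<longlonglongrightarrow> (g t - g t)\<^sup>2" by (intro tendsto_intros lim)
      then show "(\<lambda>i. (s i t - g t)\<^sup>2) \<longlonglongrightarrow> 0" by simp
    qed
  qed (use ig bd3 in auto)
  then have e_lim: "e \<longlonglongrightarrow> 0" by (simp add: e_def[abs_def])
  define X where "X i = simple_fc (s i) x" for i
  have diff_sq: "(norm (X i - X j))\<^sup>2 \<le> 2 * e i + 2 * e j" for i j
  proof -
    have XX: "inner (X i) (X j) = (\<integral>t. s i t * s j t \<partial>spec_meas E x)" for i j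
      using inner_simple_fc_simple_fc[OF s s, of UNIV i x j] by (simp add: X_def E_UNIV)
    have "(norm (X i - X j))\<^sup>2 = (\<integral>t. s i t * s i t - 2 * (s i t * s j t) + s j t * s j t \<partial>spec_meas E x)"
      using int_ss by (simp add: power2_norm_eq_inner inner_diff_left inner_diff_right XX mult.commute)
    \<comment> \<open>The integrand is the square of \<open>s i t - s j t\<close>; inserting
      \<open>g t\<close> bounds it by the two approximation errors.\<close>
    also have "\<dots> \<le> (\<integral>t. 2 * (s i t - g t)\<^sup>2 + 2 * (s j t - g t)\<^sup>2 \<partial>spec_meas E x)"
    proof (rule integral_mono)
      fix t
      have "0 \<le> ((s i t - g t) + (s j t - g t))\<^sup>2" by simp
      then show "s i t * s i t - 2 * (s i t * s j t) + s j t * s j t \<le> 2 * (s i t - g t)\<^sup>2 + 2 * (s j t - g t)\<^sup>2"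
        by (simp add: power2_eq_square algebra_simps)
    qed (use int_ss int_sg in auto)
    also have "\<dots> = 2 * e i + 2 * e j" using int_sg by (simp add: e_def)
    finally show ?thesis .
  qed
  have "Cauchy X"
  proof (rule CauchyI)
    fix \<epsilon> :: real assume "\<epsilon> > 0"
    then have "\<forall>\<^sub>F i in sequentially. e i < \<epsilon>\<^sup>2 / 4"
      using e_lim by (intro order_tendstoD(2)) auto
    then obtain N where N: "\<And>i. i \<ge> N \<Longrightarrow> e i < \<epsilon>\<^sup>2 / 4"
      by (auto simp: eventually_sequentially)
    have "norm (X i - X j) < \<epsilon>" if "i \<ge> N" "j \<ge> N" for i j
    proof -
      have "(norm (X i - X j))\<^sup>2 < \<epsilon>\<^sup>2" using diff_sq[of i j] N[OF that(1)] N[OF that(2)] by linarith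
      then show ?thesis using \<open>\<epsilon> > 0\<close> by (simp add: power_less_imp_less_base)
    qed
    then show "\<exists>M. \<forall>m\<ge>M. \<forall>n\<ge>M. norm (X m - X n) < \<epsilon>" by blast
  qed
  then obtain y where y: "X \<longlonglongrightarrow> y" by (auto simp: Cauchy_convergent_iff convergent_def)
  have "fc_rel E g x y"
    unfolding fc_rel_def
  proof (intro conjI ballI x)
    fix z assume z: "z \<in> fc_dom E g"
    have lims: "(\<lambda>i. \<integral>t. s i t \<partial>spec_meas E u) \<longlonglongrightarrow> (\<integral>t. g t \<partial>spec_meas E u)"
      if "u \<in> fc_dom E g" for u
      by (rule integral_dominated_convergence[where w = "\<lambda>t. 2 * \<bar>g t\<bar>"])
         (use integrable_fc_dom[OF g that] bd lim in auto)
    have "inner (X i) z = ((\<integral>t. s i t \<partial>spec_meas E (x + z)) - (\<integral>t. s i t \<partial>spec_meas E (x - z))) / 4" for i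
      using inner_simple_fc[OF s, of UNIV i x z] by (simp add: X_def E_UNIV)
    then have "(\<lambda>i. inner (X i) z) \<longlonglongrightarrow>
        ((\<integral>t. g t \<partial>spec_meas E (x + z)) - (\<integral>t. g t \<partial>spec_meas E (x - z))) / 4"
      by (simp only:) (intro tendsto_intros lims fc_dom_add fc_dom_diff x z g, simp)
    moreover have "(\<lambda>i. inner (X i) z) \<longlonglongrightarrow> inner y z" by (intro tendsto_intros y)
    ultimately show "inner y z = ((\<integral>t. g t \<partial>spec_meas E (x + z)) - (\<integral>t. g t \<partial>spec_meas E (x - z))) / 4"
      by (metis LIMSEQ_unique)
  qed
  moreover have "spec_meas E y = density (spec_meas E x) (\<lambda>t. ennreal ((g t)\<^sup>2))"
  proof (rule measure_eqI)
    fix C assume "C \<in> sets (spec_meas E y)"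
    then have C [measurable]: "C \<in> sets borel" by simp
    have "(\<lambda>i. \<integral>t. indicator C t * (s i t * s i t) \<partial>spec_meas E x)
       \<longlonglongrightarrow> (\<integral>t. indicator C t * (g t * g t) \<partial>spec_meas E x)"
    proof (rule integral_dominated_convergence[where w = "\<lambda>t. 4 * (g t)\<^sup>2"])
      show "AE t in spec_meas E x. norm (indicator C t * (s i t * s i t)) \<le> 4 * (g t)\<^sup>2" for i
        using bd2[of i _ i] by (auto simp: indicator_def)
      show "AE t in spec_meas E x. (\<lambda>i. indicator C t * (s i t * s i t)) \<longlonglongrightarrow> indicator C t * (g t * g t)"
        by (intro AE_I2 tendsto_intros lim)
    qed (use ig in auto)
    then have "(\<lambda>i. inner (E C (X i)) (X i)) \<longlonglongrightarrow> (\<integral>t. indicator C t * (g t * g t) \<partial>spec_meas E x)"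
      by (simp only: X_def inner_simple_fc_simple_fc[OF s s C])
    moreover have "(\<lambda>i. inner (E C (X i)) (X i)) \<longlonglongrightarrow> inner (E C y) y"
      by (intro tendsto_intros bounded_linear.tendsto[OF E_bounded_linear[OF C]] y)
    ultimately have "inner (E C y) y = (\<integral>t. indicator C t * (g t * g t) \<partial>spec_meas E x)"
      by (rule LIMSEQ_unique[rotated])
    then have "ennreal ((norm (E C y))\<^sup>2) = ennreal (\<integral>t. indicator C t * (g t)\<^sup>2 \<partial>spec_meas E x)"
      unfolding E_norm_sq[OF C] by (simp add: power2_eq_square)
    also have "\<dots> = (\<integral>\<^sup>+t. ennreal (indicator C t * (g t)\<^sup>2) \<partial>spec_meas E x)"
      using ig by (intro nn_integral_eq_integral[symmetric])
        (auto intro!: Bochner_Integration.integrable_bound[OF ig] simp: indicator_def)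
    also have "\<dots> = (\<integral>\<^sup>+t. ennreal ((g t)\<^sup>2) * indicator C t \<partial>spec_meas E x)"
      by (intro nn_integral_cong) (auto simp: indicator_def)
    finally show "emeasure (spec_meas E y) C = emeasure (density (spec_meas E x) (\<lambda>t. ennreal ((g t)\<^sup>2))) C"
      by (simp add: emeasure_density emeasure_spec_meas)
  qed simp
  ultimately show ?thesis by blast
qed

text \<open>Continuity of \<open>E\<close> is only given for disjoint families, so the increasing
  sets \<open>\<bar>g\<bar> \<le> n\<close> are first made disjoint. Together with the next lemma
  this shows that \<open>fc_dom E g\<close> is dense.\<close>

lemma LIMSEQ_E_bounded_part:
  fixes g :: "real \<Rightarrow> real"
  assumes [measurable]: "g \<in> borel_measurable borel"
  shows "(\<lambda>n. E {t. \<bar>g t\<bar> \<le> real n} x) \<longlonglongrightarrow> x"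
proof -
  define A where "A n = {t. \<bar>g t\<bar> \<le> real n}" for n
  define D where "D = disjointed (\<lambda>n. A n)"
  have A: "A n \<in> sets borel" for n unfolding A_def by measurable
  have inc: "incseq A" by (auto simp: A_def incseq_def)
  have "range D \<subseteq> sets borel"
    unfolding D_def using A by (intro sets.range_disjointed_sets) auto
  moreover have "disjoint_family D" unfolding D_def by (rule disjoint_family_disjointed)
  moreover have U: "(\<Union>i. D i) = UNIV"
    unfolding D_def UN_disjointed_eq by (auto simp: A_def real_arch_simple)
  ultimately have "(\<lambda>n. E (\<Union>i<n. D i) x) \<longlonglongrightarrow> x"
    using spectral_measure_LIMSEQ[OF spectral, of D x] by (simp add: E_UNIV)
  \<comment> \<open>The first \<open>Suc n\<close> pieces fill exactly \<open>A n\<close>, hence the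
    shift of the index.\<close>
  then have "(\<lambda>n. E (\<Union>i<Suc n. D i) x) \<longlonglongrightarrow> x" by (rule LIMSEQ_Suc)
  moreover have "(\<Union>i<Suc n. D i) = A n" for n
  proof -
    have "(\<Union>i<Suc n. D i) = (\<Union>i<Suc n. A i)"
      using finite_UN_disjointed_eq[of A "Suc n"] by (simp only: D_def atLeast0LessThan)
    also have "\<dots> = A n" using inc by (force simp: incseq_def less_Suc_eq_le)
    finally show ?thesis .
  qed
  ultimately show ?thesis by (simp add: A_def)
qed

lemma E_bounded_part_in_fc_dom:
  assumes [measurable]: "g \<in> borel_measurable borel"
  shows "E {t. \<bar>g t\<bar> \<le> real n} x \<in> fc_dom E g"
proof -
  have "(\<integral>\<^sup>+t. ennreal ((g t)\<^sup>2) \<partial>spec_meas E (E {t. \<bar>g t\<bar> \<le> real n} x))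
    = (\<integral>\<^sup>+t. indicator {t. \<bar>g t\<bar> \<le> real n} t * ennreal ((g t)\<^sup>2) \<partial>spec_meas E x)"
    by (subst spec_meas_E, measurable) (rule nn_integral_density, auto)
  also have "\<dots> \<le> (\<integral>\<^sup>+t. ennreal ((real n)\<^sup>2) \<partial>spec_meas E x)"
    by (intro nn_integral_mono) (auto simp: indicator_def abs_le_square_iff[symmetric] intro!: ennreal_leI)
  also have "\<dots> < \<infinity>"
    by (simp add: emeasure_spec_meas_UNIV ennreal_mult_less_top)
  finally show ?thesis by (simp add: fc_dom_iff_nn_integral)
qed

text \<open>\<open>fc_rel\<close> tests only against vectors of \<open>fc_dom E g\<close>; these are
  dense, so the difference is orthogonal to itself. Thus the \<open>THE\<close> in \<open>fc\<close>
  is well defined.\<close>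

lemma fc_rel_unique:
  assumes "g \<in> borel_measurable borel" "fc_rel E g x y" "fc_rel E g x y'"
  shows "y = y'"
proof -
  have "inner y z = inner y' z" if "z \<in> fc_dom E g" for z
    using assms(2,3) that unfolding fc_rel_def by metis
  then have "inner (y - y') z = 0" if "z \<in> fc_dom E g" for z
    using that by (simp add: inner_diff_left)
  moreover have "(\<lambda>n. inner (y - y') (E {t. \<bar>g t\<bar> \<le> real n} (y - y'))) \<longlonglongrightarrow> inner (y - y') (y - y')"
    by (intro tendsto_intros LIMSEQ_E_bounded_part assms)
  ultimately have "inner (y - y') (y - y') = 0"
    using E_bounded_part_in_fc_dom[OF assms(1)] by (simp add: LIMSEQ_const_iff)
  then show ?thesis by simp
qed

lemma spec_meas_fc_rel:
  assumes "g \<in> borel_measurable borel" "fc_rel E g x y"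
  shows "spec_meas E y = density (spec_meas E x) (\<lambda>t. ennreal ((g t)\<^sup>2))"
proof -
  have "x \<in> fc_dom E g" using assms(2) by (simp add: fc_rel_def)
  then obtain y' where "fc_rel E g x y'" "spec_meas E y' = density (spec_meas E x) (\<lambda>t. ennreal ((g t)\<^sup>2))"
    using fc_rel_exists[OF assms(1)] by blast
  moreover from this have "y' = y" using fc_rel_unique assms by blast
  ultimately show ?thesis by simp
qed

lemma fc_rel_fc:
  assumes "g \<in> borel_measurable borel" "x \<in> fc_dom E g"
  shows "fc_rel E g x (fc E g x)"
proof -
  obtain y where y: "fc_rel E g x y" using fc_rel_exists[OF assms] by blast
  show ?thesis
    unfolding fc_def by (rule theI[of "fc_rel E g x", OF y]) (rule fc_rel_unique[OF assms(1) _ y])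
qed

lemma norm_sq_nn_integral:
  assumes "g \<in> borel_measurable borel" "fc_rel E g x y"
  shows "ennreal ((norm y)\<^sup>2) = (\<integral>\<^sup>+t. ennreal ((g t)\<^sup>2) \<partial>spec_meas E x)"
  using emeasure_spec_meas_UNIV[of y] assms by (simp add: spec_meas_fc_rel emeasure_density)

text \<open>Take \<open>z = x\<close> in \<open>fc_rel\<close>: the measure of \<open>x + x\<close>
  is four times that of \<open>x\<close>, and that of \<open>x - x\<close> is null.\<close>

lemma inner_fc_rel:
  assumes "g \<in> borel_measurable borel" "fc_rel E g x y"
  shows "inner y x = (\<integral>t. g t \<partial>spec_meas E x)"
proof -
  have "spec_meas E (x + x) = density (spec_meas E x) (\<lambda>t. 4)"
  proof (rule measure_eqI)
    fix A assume "A \<in> sets (spec_meas E (x + x))"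
    then show "emeasure (spec_meas E (x + x)) A = emeasure (density (spec_meas E x) (\<lambda>t. 4)) A"
      by (simp add: emeasure_density nn_integral_cmult emeasure_spec_meas linear_cmul[OF E_linear]
          power_mult_distrib ennreal_mult flip: scaleR_2)
  qed simp
  then have "spec_meas E (x + x) = density (spec_meas E x) (\<lambda>t. ennreal 4)" by simp
  then have "(\<integral>t. g t \<partial>spec_meas E (x + x)) = 4 * (\<integral>t. g t \<partial>spec_meas E x)"
    using assms(1) by (simp only:, subst integral_density) auto
  moreover have "(\<integral>t. g t \<partial>spec_meas E 0) = 0"
    by (rule integral_eq_zero_AE, rule AE_I[where N = UNIV]) (auto simp: emeasure_spec_meas_UNIV)
  ultimately show ?thesis
    using assms(2) unfolding fc_rel_def by (metis diff_zero cancel_comm_monoid_add_class.diff_cancel nonzero_mult_div_cancel_left zero_neq_numeral)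
qed

end

subsection \<open>Determination of the spectral measure by moments\<close>

text \<open>Moments fix the integrals of polynomials; on the common compact support Weierstrass
  carries this to bounded continuous functions, and ramps carry it to the half-lines, which
  determine a finite Borel measure.\<close>

lemma finite_measure_eqI_moments:
  fixes M N :: "real measure"
  assumes fin: "finite_measure M" "finite_measure N"
    and sets: "sets M = sets borel" "sets N = sets borel"
    and bd: "AE t in M. \<bar>t\<bar> \<le> K" "AE t in N. \<bar>t\<bar> \<le> K"
    and moments: "\<And>n. (\<integral>t. t ^ n \<partial>M) = (\<integral>t. t ^ n \<partial>N)"
  shows "M = N"
proof (rule measure_eqI_lessThan[OF sets])
  interpret M: finite_measure M by fact
  interpret N: finite_measure N by fact
  note [measurable_cong] = sets
  have int_pow: "integrable L (\<lambda>t. t ^ n)"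
    if "finite_measure L" "AE t in L. \<bar>t\<bar> \<le> K" "sets L = sets borel" for L :: "real measure" and n
  proof -
    note [measurable_cong] = that(3)
    show ?thesis
      by (rule finite_measure.integrable_const_bound[OF that(1), where B = "K ^ n"])
         (use that(2) in \<open>auto simp: power_abs elim!: eventually_mono intro: power_mono\<close>)
  qed
  have poly: "integrable M p \<and> integrable N p \<and> (\<integral>t. p t \<partial>M) = (\<integral>t. p t \<partial>N)"
    if "real_polynomial_function p" for p :: "real \<Rightarrow> real"
  proof -
    obtain a n where "p = (\<lambda>t. \<Sum>i\<le>n. a i * t ^ i)"
      using \<open>real_polynomial_function p\<close> by (auto simp: real_polynomial_function_iff_sum)
    then show ?thesis
      using int_pow[OF fin(1) bd(1) sets(1)] int_pow[OF fin(2) bd(2) sets(2)] moments by simp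
  qed
  have cont: "(\<integral>t. f t \<partial>M) = (\<integral>t. f t \<partial>N)"
    if f: "continuous_on UNIV f" "\<And>t. \<bar>f t\<bar> \<le> 1" for f :: "real \<Rightarrow> real"
  proof -
    have [measurable]: "f \<in> borel_measurable borel" using f(1) by (rule borel_measurable_continuous_onI)
    have int_f: "integrable M f" "integrable N f"
      by (rule M.integrable_const_bound[where B = 1] N.integrable_const_bound[where B = 1]; use f(2) in simp)+
    define c where "c = measure M (space M) + measure N (space N)"
    have "\<bar>(\<integral>t. f t \<partial>M) - (\<integral>t. f t \<partial>N)\<bar> \<le> \<epsilon> * c" if "\<epsilon> > 0" for \<epsilon>
    proof -
      obtain p where p: "real_polynomial_function p" "\<And>t. t \<in> {-K..K} \<Longrightarrow> \<bar>f t - p t\<bar> < \<epsilon>"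
        using Stone_Weierstrass_real_polynomial_function[of "{-K..K}" f \<epsilon>] f(1) \<open>\<epsilon> > 0\<close>
          continuous_on_subset by blast
      have p_near: "\<bar>f t - p t\<bar> \<le> \<epsilon>" if "\<bar>t\<bar> \<le> K" for t
        using p(2)[of t] that by (simp add: abs_le_iff less_imp_le)
      note pp = poly[OF p(1)]
      have est: "\<bar>(\<integral>t. f t \<partial>L) - (\<integral>t. p t \<partial>L)\<bar> \<le> \<epsilon> * measure L (space L)"
        if L: "finite_measure L" "AE t in L. \<bar>t\<bar> \<le> K" "integrable L f" "integrable L p" for L
      proof -
        interpret L: finite_measure L by fact
        have "\<bar>(\<integral>t. f t \<partial>L) - (\<integral>t. p t \<partial>L)\<bar> = \<bar>\<integral>t. f t - p t \<partial>L\<bar>" using L by simp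
        also have "\<dots> \<le> (\<integral>t. \<bar>f t - p t\<bar> \<partial>L)" by (rule integral_abs_bound)
        also have "\<dots> \<le> (\<integral>t. \<epsilon> \<partial>L)"
          by (rule integral_mono_AE) (use L p_near in \<open>auto elim!: eventually_mono\<close>)
        finally show ?thesis by (simp add: mult.commute)
      qed
      show ?thesis
        using est[OF fin(1) bd(1) int_f(1)] est[OF fin(2) bd(2) int_f(2)] pp
        by (simp add: c_def distrib_left)
    qed
    moreover have "c \<ge> 0" by (simp add: c_def)
    ultimately have "\<bar>(\<integral>t. f t \<partial>M) - (\<integral>t. f t \<partial>N)\<bar> \<le> 0 + e" if "e > 0" for e
    proof -
      \<comment> \<open>Both measures may be null, so the tolerance is divided by
        \<open>c + 1\<close> rather than by \<open>c\<close>.\<close>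
      have "\<bar>(\<integral>t. f t \<partial>M) - (\<integral>t. f t \<partial>N)\<bar> \<le> e / (c + 1) * c"
        using \<open>\<And>\<epsilon>. \<epsilon> > 0 \<Longrightarrow> _ \<le> \<epsilon> * c\<close>[of "e / (c + 1)"] \<open>c \<ge> 0\<close> \<open>e > 0\<close> by simp
      also have "\<dots> \<le> e" using \<open>c \<ge> 0\<close> \<open>e > 0\<close> by (simp add: field_simps)
      finally show ?thesis by simp
    qed
    then show ?thesis using field_le_epsilon by (metis abs_le_zero_iff eq_iff_diff_eq_0)
  qed
  fix a :: real
  show "emeasure M {a<..} < \<infinity>" by (simp add: M.emeasure_eq_measure)
  \<comment> \<open>Continuous ramps converging pointwise to the indicator of the open
    half-line.\<close>
  define f where "f n t = min 1 (max 0 (real n * (t - a)))" for n t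
  have meas_f [measurable]: "f n \<in> borel_measurable borel" for n unfolding f_def by measurable
  have lim_f: "(\<lambda>n. f n t) \<longlonglongrightarrow> indicator {a<..} t" for t
  proof (cases "t > a")
    case True
    obtain n0 where n0: "1 / (t - a) \<le> real n0" using real_arch_simple by blast
    have "f n t = 1" if "n \<ge> n0" for n
    proof -
      have "1 / (t - a) \<le> real n" using n0 that by linarith
      then show ?thesis using True by (simp add: f_def field_simps)
    qed
    then show ?thesis using True by (intro tendsto_eventually) (auto simp: eventually_sequentially)
  next
    case False
    then have "f n t = 0" for n by (simp add: f_def mult_nonneg_nonpos max_absorb1)
    then show ?thesis using False by simp
  qed
  have lim: "(\<lambda>n. \<integral>t. f n t \<partial>L) \<longlonglongrightarrow> measure L {a<..}"
    if L: "finite_measure L" "sets L = sets borel" for L :: "real measure"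
  proof -
    interpret L: finite_measure L by fact
    note [measurable_cong] = L(2)
    have "(\<lambda>n. \<integral>t. f n t \<partial>L) \<longlonglongrightarrow> (\<integral>t. indicator {a<..} t \<partial>L)"
      by (rule integral_dominated_convergence[where w = "\<lambda>_. 1"]) (use lim_f in \<open>auto simp: f_def\<close>)
    then show ?thesis using L sets_eq_imp_space_eq[OF L(2)] by simp
  qed
  have "(\<integral>t. f n t \<partial>M) = (\<integral>t. f n t \<partial>N)" for n
    by (rule cont) (auto simp: f_def intro!: continuous_intros)
  then have "measure M {a<..} = measure N {a<..}"
    using lim[OF fin(1) sets(1)] lim[OF fin(2) sets(2)] by (simp add: LIMSEQ_unique)
  then show "emeasure M {a<..} = emeasure N {a<..}"
    by (simp add: M.emeasure_eq_measure N.emeasure_eq_measure)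
qed

section \<open>Finite additivity recovered from the represented operators\<close>

text \<open>The set function vanishes at the zero vector, so both branches of
  \<open>measure_of\<close> give the null measure.\<close>

lemma spec_meas_zero:
  assumes "spectral_measure E"
  shows "spec_meas E 0 = null_measure borel"
proof (rule measure_eqI)
  fix A assume "A \<in> sets (spec_meas E 0)"
  then have "E A 0 = 0"
    using spectral_measure_bounded_linear[OF assms, THEN bounded_linear.linear] by (simp add: linear_0)
  then show "emeasure (spec_meas E 0) A = emeasure (null_measure borel) A"
    by (simp add: spec_meas_def emeasure_measure_of_conv)
qed simp

text \<open>The additivity defect is linear in the vector, so it persists for \<open>x + x\<close>.
  With \<open>z = x\<close> both measures in \<open>fc_rel\<close> are then null.\<close>

lemma inner_fc_rel_eq_0_if_not_additive:
  assumes E: "spectral_measure E" and AB: "A \<in> sets borel" "B \<in> sets borel" "A \<inter> B = {}"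
    and neq: "E (A \<union> B) x \<noteq> E A x + E B x" and rel: "fc_rel E g x y"
  shows "inner y x = 0"
proof -
  note lin = spectral_measure_bounded_linear[OF E, THEN bounded_linear.linear]
  have "E (A \<union> B) (x + x) \<noteq> E A (x + x) + E B (x + x)"
  proof
    assume "E (A \<union> B) (x + x) = E A (x + x) + E B (x + x)"
    then have "2 *\<^sub>R E (A \<union> B) x = 2 *\<^sub>R (E A x + E B x)"
      using AB by (simp add: linear_cmul[OF lin] scaleR_right_distrib flip: scaleR_2)
    with neq show False by simp
  qed
  then have "spec_meas E (x + x) = null_measure borel"
    by (rule spec_meas_eq_null_measure[OF E AB])
  then show ?thesis
    using rel spec_meas_zero[OF E] by (auto simp: fc_rel_def)
qed

text \<open>Vectors at which additivity fails form the complement of a subspace, lie in the domain and annihilate the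
  quadratic form of \<open>T\<close>. If there is one, they span the whole space, and polarisation gives \<open>T = 0\<close>.\<close>

lemma selfadjoint_spectral_resolution_additive:
  fixes E :: "real set \<Rightarrow> 'x \<Rightarrow> 'x::{real_inner, complete_space}"
  assumes T: "selfadjoint_op D T" and unbdd: "\<not> (\<exists>C. \<forall>u\<in>D. norm (T u) \<le> C * norm u)"
    and res: "spectral_resolution_of E D T"
  shows "projection_valued_measure E"
proof (rule ccontr)
  have E: "spectral_measure E" and D: "D = fc_dom E (\<lambda>t. t)"
    and rel: "\<And>u. u \<in> D \<Longrightarrow> fc_rel E (\<lambda>t. t) u (T u)"
    using res by (auto simp: spectral_resolution_of_def)
  have sub: "subspace D" and T_lin: "\<And>u v s t. u \<in> D \<Longrightarrow> v \<in> D \<Longrightarrow> T (s *\<^sub>R u + t *\<^sub>R v) = s *\<^sub>R T u + t *\<^sub>R T v"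
    and T_sym: "\<And>u v. u \<in> D \<Longrightarrow> v \<in> D \<Longrightarrow> inner (T u) v = inner u (T v)"
    using T by (auto simp: selfadjoint_op_def)
  note lin = spectral_measure_bounded_linear[OF E, THEN bounded_linear.linear]
  assume "\<not> projection_valued_measure E"
  then obtain A B y where AB: "A \<in> sets borel" "B \<in> sets borel" "A \<inter> B = {}"
    and y: "E (A \<union> B) y \<noteq> E A y + E B y"
    using E by (auto simp: projection_valued_measure_def)
  define good where "good x \<longleftrightarrow> E (A \<union> B) x = E A x + E B x" for x
  \<comment> \<open>The measure of a bad vector is null, and every function is integrable for
    it.\<close>
  have bad_D: "x \<in> D" if "\<not> good x" for x
    using spec_meas_eq_null_measure[OF E AB, of x] that by (simp add: D fc_dom_def good_def)
  have bad_add: "\<not> good (x + r *\<^sub>R y)" if "good x" "r \<noteq> 0" for x r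
    using that y AB
    by (auto simp: good_def linear_add[OF lin] linear_cmul[OF lin] algebra_simps)
       (metis real_vector.scale_cancel_left scaleR_right_distrib)
  \<comment> \<open>A good vector is the difference of the bad vectors \<open>x + y\<close> and
    \<open>y\<close>.\<close>
  have D_UNIV: "x \<in> D" for x
  proof (cases "good x")
    case True
    then have "x + 1 *\<^sub>R y \<in> D" "y \<in> D" using bad_add[of x 1] y by (auto intro!: bad_D simp: good_def)
    then have "x + y - y \<in> D" using sub by (intro subspace_diff) auto
    then show ?thesis by simp
  qed (rule bad_D)
  have T_add: "T (u + r *\<^sub>R v) = T u + r *\<^sub>R T v" for u v r
    using T_lin[OF D_UNIV D_UNIV, of 1 u r v] by simp
  have bad_0: "inner (T x) x = 0" if "\<not> good x" for x
    using inner_fc_rel_eq_0_if_not_additive[OF E AB _ rel[OF D_UNIV]] that by (simp add: good_def)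
  have all_0: "inner (T x) x = 0" for x
  proof (cases "good x")
    case True
    \<comment> \<open>Adding the two identities cancels the mixed terms and leaves the forms at
      \<open>x\<close> and at the bad vector \<open>y\<close>.\<close>
    have "inner (T (x + 1 *\<^sub>R y)) (x + 1 *\<^sub>R y) = 0" "inner (T (x + (-1) *\<^sub>R y)) (x + (-1) *\<^sub>R y) = 0"
      by (rule bad_0, rule bad_add, rule True, simp)+
    moreover have "inner (T y) y = 0" using y by (intro bad_0) (simp add: good_def)
    ultimately show ?thesis unfolding T_add by (simp add: inner_add_left inner_add_right inner_diff_left inner_diff_right)
  qed (rule bad_0)
  have "T u = 0" for u
  proof -
    \<comment> \<open>By symmetry the mixed terms sum to twice the squared norm of
      \<open>T u\<close>.\<close>
    have "inner (T (u + 1 *\<^sub>R T u)) (u + 1 *\<^sub>R T u) = 0" by (rule all_0)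
    then have "inner (T u) (T u) + inner (T (T u)) u = 0"
      unfolding T_add using all_0[of u] all_0[of "T u"] by (simp add: inner_add_left inner_add_right)
    then show ?thesis using T_sym[OF D_UNIV D_UNIV, of "T u" u] by simp
  qed
  then show False using unbdd by (metis mult_zero_left norm_zero order_refl)
qed

text \<open>A vector at which additivity fails is nonzero but annihilates the quadratic form, which
  definiteness excludes.\<close>

lemma definite_spectral_resolution_additive:
  fixes E :: "real set \<Rightarrow> 'x \<Rightarrow> 'x::{real_inner, complete_space}"
  assumes res: "spectral_resolution_of E UNIV T" and pos: "\<And>u. u \<noteq> 0 \<Longrightarrow> inner (T u) u \<noteq> 0"
  shows "projection_valued_measure E"
proof
  show E: "spectral_measure E" using res by (simp add: spectral_resolution_of_def)
  fix A B :: "real set" and x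
  assume AB: "A \<in> sets borel" "B \<in> sets borel" "A \<inter> B = {}"
  show "E (A \<union> B) x = E A x + E B x"
  proof (rule ccontr)
    assume neq: "E (A \<union> B) x \<noteq> E A x + E B x"
    then have "x \<noteq> 0"
      using AB spectral_measure_bounded_linear[OF E, THEN bounded_linear.linear] by (auto simp: linear_0)
    moreover have "fc_rel E (\<lambda>t. t) x (T x)" using res by (simp add: spectral_resolution_of_def)
    ultimately show False using inner_fc_rel_eq_0_if_not_additive[OF E AB neq] pos by blast
  qed
qed

section \<open>Supports of the scalar measures and comparison of the two resolutions\<close>

lemma ennreal_add_le_self_imp_eq_0:
  fixes a b :: ennreal
  assumes "a + b \<le> b" "b < \<infinity>"
  shows "a = 0"
  using assms ennreal_add_left_cancel_le[of b a 0] by (auto simp: add.commute)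

text \<open>Apply the lower bound to the projection of \<open>x\<close> onto
  \<open>\<bar>t\<bar> < m\<close>: the integral of \<open>m^2 - t^2\<close> over this set is at
  most 0, although the integrand is positive there, so the set is null.\<close>

lemma (in projection_valued_measure) AE_spec_meas_ge:
  assumes res: "\<And>u. u \<in> fc_dom E (\<lambda>t. t) \<Longrightarrow> fc_rel E (\<lambda>t. t) u (T u)"
    and below: "\<And>u. u \<in> fc_dom E (\<lambda>t. t) \<Longrightarrow> m * norm u \<le> norm (T u)" and m: "m > 0"
  shows "AE t in spec_meas E x. m \<le> \<bar>t\<bar>"
proof -
  define C where "C = {t::real. \<bar>t\<bar> < m}"
  have C [measurable]: "C \<in> sets borel" unfolding C_def by measurable
  let ?b = "\<integral>\<^sup>+t. indicator C t * ennreal (t\<^sup>2) \<partial>spec_meas E x"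
  have b: "(\<integral>\<^sup>+t. ennreal (t\<^sup>2) \<partial>spec_meas E (E C x)) = ?b"
    by (subst spec_meas_E[OF C], rule nn_integral_density) auto
  have "?b \<le> (\<integral>\<^sup>+t. ennreal (m\<^sup>2) \<partial>spec_meas E x)"
    by (intro nn_integral_mono) (auto simp: C_def indicator_def intro!: ennreal_leI abs_le_square_iff[THEN iffD1])
  also have "\<dots> < \<infinity>" by (simp add: emeasure_spec_meas_UNIV ennreal_mult_less_top)
  finally have b_fin: "?b < \<infinity>" .
  then have dom: "E C x \<in> fc_dom E (\<lambda>t. t)" by (simp add: fc_dom_iff_nn_integral b)
  have "(m * norm (E C x))\<^sup>2 \<le> (norm (T (E C x)))\<^sup>2"
    using below[OF dom] m by (intro power_mono) auto
  then have "ennreal ((m * norm (E C x))\<^sup>2) \<le> ?b"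
    unfolding b[symmetric] norm_sq_nn_integral[OF _ res[OF dom], simplified, symmetric] by (rule ennreal_leI)
  moreover have "ennreal ((m * norm (E C x))\<^sup>2) = (\<integral>\<^sup>+t. ennreal (m\<^sup>2) * indicator C t \<partial>spec_meas E x)"
    by (simp add: nn_integral_cmult emeasure_spec_meas power_mult_distrib ennreal_mult)
  moreover have "\<dots> = (\<integral>\<^sup>+t. indicator C t * ennreal (m\<^sup>2 - t\<^sup>2) + indicator C t * ennreal (t\<^sup>2) \<partial>spec_meas E x)"
  proof (rule nn_integral_cong)
    fix t
    show "ennreal (m\<^sup>2) * indicator C t = indicator C t * ennreal (m\<^sup>2 - t\<^sup>2) + indicator C t * ennreal (t\<^sup>2)"
      using abs_le_square_iff[of t m] by (auto simp: C_def indicator_def simp flip: ennreal_plus)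
  qed
  moreover have "\<dots> = (\<integral>\<^sup>+t. indicator C t * ennreal (m\<^sup>2 - t\<^sup>2) \<partial>spec_meas E x) + ?b"
    by (rule nn_integral_add) auto
  ultimately have "(\<integral>\<^sup>+t. indicator C t * ennreal (m\<^sup>2 - t\<^sup>2) \<partial>spec_meas E x) = 0"
    using b_fin by (intro ennreal_add_le_self_imp_eq_0[of _ ?b]) (simp_all only:)
  then have "AE t in spec_meas E x. indicator C t * ennreal (m\<^sup>2 - t\<^sup>2) = 0"
    by (subst (asm) nn_integral_0_iff_AE) auto
  then show ?thesis
  proof (rule eventually_mono)
    fix t assume *: "indicator C t * ennreal (m\<^sup>2 - t\<^sup>2) = 0"
    show "m \<le> \<bar>t\<bar>"
    proof (rule ccontr)
      assume "\<not> m \<le> \<bar>t\<bar>"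
      then have "\<bar>t\<bar> < m" by simp
      then have "t\<^sup>2 < m\<^sup>2" using power_strict_mono[of "\<bar>t\<bar>" m 2] by simp
      with * \<open>\<bar>t\<bar> < m\<close> show False by (simp add: C_def ennreal_eq_0_iff)
    qed
  qed
qed

text \<open>The mirror image of the preceding argument, with the projection onto
  \<open>\<bar>t\<bar> > K\<close> and the excess \<open>t^2 - K^2\<close>.\<close>

lemma (in projection_valued_measure) AE_spec_meas_le:
  assumes res: "\<And>u. fc_rel E (\<lambda>t. t) u (T u)"
    and above: "\<And>u. norm (T u) \<le> K * norm u" and K: "K \<ge> 0"
  shows "AE t in spec_meas E x. \<bar>t\<bar> \<le> K"
proof -
  define C where "C = {t::real. \<bar>t\<bar> > K}"
  have C [measurable]: "C \<in> sets borel" unfolding C_def by measurable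
  let ?b = "\<integral>\<^sup>+t. ennreal (K\<^sup>2) * indicator C t \<partial>spec_meas E x"
  have b: "?b = ennreal ((K * norm (E C x))\<^sup>2)"
    by (simp add: nn_integral_cmult emeasure_spec_meas power_mult_distrib ennreal_mult)
  have "(norm (T (E C x)))\<^sup>2 \<le> (K * norm (E C x))\<^sup>2"
    using above by (intro power_mono) auto
  then have "(\<integral>\<^sup>+t. ennreal (t\<^sup>2) \<partial>spec_meas E (E C x)) \<le> ?b"
    unfolding b norm_sq_nn_integral[OF _ res, simplified, symmetric] by (rule ennreal_leI)
  moreover have "(\<integral>\<^sup>+t. ennreal (t\<^sup>2) \<partial>spec_meas E (E C x)) = (\<integral>\<^sup>+t. indicator C t * ennreal (t\<^sup>2) \<partial>spec_meas E x)"
    by (subst spec_meas_E[OF C], rule nn_integral_density) auto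
  moreover have "\<dots> = (\<integral>\<^sup>+t. indicator C t * ennreal (t\<^sup>2 - K\<^sup>2) + ennreal (K\<^sup>2) * indicator C t \<partial>spec_meas E x)"
  proof (rule nn_integral_cong)
    fix t
    show "indicator C t * ennreal (t\<^sup>2) = indicator C t * ennreal (t\<^sup>2 - K\<^sup>2) + ennreal (K\<^sup>2) * indicator C t"
      using abs_le_square_iff[of K t] K by (auto simp: C_def indicator_def simp flip: ennreal_plus)
  qed
  moreover have "\<dots> = (\<integral>\<^sup>+t. indicator C t * ennreal (t\<^sup>2 - K\<^sup>2) \<partial>spec_meas E x) + ?b"
    by (rule nn_integral_add) auto
  ultimately have "(\<integral>\<^sup>+t. indicator C t * ennreal (t\<^sup>2 - K\<^sup>2) \<partial>spec_meas E x) = 0"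
    using b by (intro ennreal_add_le_self_imp_eq_0[of _ ?b]) (simp_all only: ennreal_less_top infinity_ennreal_def)
  then have "AE t in spec_meas E x. indicator C t * ennreal (t\<^sup>2 - K\<^sup>2) = 0"
    by (subst (asm) nn_integral_0_iff_AE) auto
  then show ?thesis
  proof (rule eventually_mono)
    fix t assume *: "indicator C t * ennreal (t\<^sup>2 - K\<^sup>2) = 0"
    show "\<bar>t\<bar> \<le> K"
    proof (rule ccontr)
      assume "\<not> \<bar>t\<bar> \<le> K"
      then have "K < \<bar>t\<bar>" by simp
      then have "K\<^sup>2 < t\<^sup>2" using power_strict_mono[of K "\<bar>t\<bar>" 2] K by simp
      with * \<open>K < \<bar>t\<bar>\<close> show False by (simp add: C_def ennreal_eq_0_iff)
    qed
  qed
qed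

text \<open>Both resolutions represent the same operator \<open>G\<close>. The bound on
  \<open>g\<close> bounds \<open>G\<close>, which confines both measures to \<open>[-K, K]\<close>,
  and equality of moments then suffices.\<close>

lemma spec_meas_eq_distr:
  fixes E EG :: "real set \<Rightarrow> 'x \<Rightarrow> 'x::{real_inner, complete_space}"
  assumes "projection_valued_measure E" "projection_valued_measure EG"
    and g [measurable]: "g \<in> borel_measurable borel"
    and g_bd: "\<And>u. AE t in spec_meas E u. \<bar>g t\<bar> \<le> K" and K: "K \<ge> 0"
    and G: "\<And>u. fc_rel E g u (G u)" and G': "\<And>u. fc_rel EG (\<lambda>t. t) u (G u)"
  shows "spec_meas EG u = distr (spec_meas E u) borel g"
proof -
  interpret E: projection_valued_measure E by fact
  interpret EG: projection_valued_measure EG by fact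
  have above: "norm (G u) \<le> K * norm u" for u
  proof -
    have "ennreal ((norm (G u))\<^sup>2) = (\<integral>\<^sup>+t. ennreal ((g t)\<^sup>2) \<partial>spec_meas E u)"
      by (rule E.norm_sq_nn_integral[OF g G])
    also have "\<dots> \<le> (\<integral>\<^sup>+t. ennreal (K\<^sup>2) \<partial>spec_meas E u)"
      by (rule nn_integral_mono_AE) (use g_bd[of u] in \<open>auto elim!: eventually_mono intro!: ennreal_leI simp: abs_le_square_iff[symmetric] K\<close>)
    also have "\<dots> = ennreal ((K * norm u)\<^sup>2)"
      by (simp add: E.emeasure_spec_meas_UNIV power_mult_distrib ennreal_mult)
    finally have "(norm (G u))\<^sup>2 \<le> (K * norm u)\<^sup>2" by (simp add: ennreal_le_iff)
    then show ?thesis using K by (auto intro: power2_le_imp_le)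
  qed
  \<comment> \<open>Passing from \<open>u\<close> to \<open>G u\<close> multiplies the measures by
    the densities \<open>t^2\<close> and \<open>g^2\<close>, which raises the moment by two. Hence
    the induction in steps of two: order 0 is the total mass, order 1 the quadratic form of
    \<open>G\<close>.\<close>
  have moments: "(\<integral>t. t ^ n \<partial>spec_meas EG u) = (\<integral>t. (g t) ^ n \<partial>spec_meas E u)" for n u
  proof (induction n arbitrary: u rule: induct_nat_012)
    case 0
    show ?case by (simp add: E.measure_spec_meas EG.measure_spec_meas E.E_UNIV EG.E_UNIV)
  next
    case 1
    show ?case using E.inner_fc_rel[OF g G] EG.inner_fc_rel[OF _ G'] by simp
  next
    case (ge2 n)
    have "(\<integral>t. t ^ n \<partial>spec_meas EG (G u)) = (\<integral>t. t\<^sup>2 *\<^sub>R t ^ n \<partial>spec_meas EG u)"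
      unfolding EG.spec_meas_fc_rel[OF _ G', simplified] by (rule integral_density) auto
    moreover have "(\<integral>t. (g t) ^ n \<partial>spec_meas E (G u)) = (\<integral>t. (g t)\<^sup>2 *\<^sub>R (g t) ^ n \<partial>spec_meas E u)"
      unfolding E.spec_meas_fc_rel[OF g G] by (rule integral_density) auto
    ultimately show ?case using ge2(1)[of "G u"] by (simp add: power2_eq_square mult.assoc)
  qed
  show ?thesis
  proof (rule finite_measure_eqI_moments[where K = K])
    show "finite_measure (distr (spec_meas E u) borel g)"
      by (rule finite_measure.finite_measure_distr[OF E.finite_measure_spec_meas]) simp
    show "AE t in spec_meas EG u. \<bar>t\<bar> \<le> K" by (rule EG.AE_spec_meas_le[OF G' above K])
    show "AE t in distr (spec_meas E u) borel g. \<bar>t\<bar> \<le> K" using g_bd by (subst AE_distr_iff) auto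
    show "(\<integral>t. t ^ n \<partial>spec_meas EG u) = (\<integral>t. t ^ n \<partial>distr (spec_meas E u) borel g)" for n
      by (subst integral_distr) (auto simp: moments)
  qed (auto intro: EG.finite_measure_spec_meas)
qed

subsection \<open>Hilbert scales\<close>

text \<open>\<open>powr\<close> is even in its base, so \<^const>\<open>Bpow\<close> yields powers of \<open>\<bar>B\<bar>\<close>; \<open>B\<close> may have negative spectrum.\<close>

lemma powr_abs_base: "\<bar>t\<bar> powr x = t powr x" for t x :: real
  by (cases "t \<ge> 0") (auto simp: uminus_powr_eq)

context projection_valued_measure
begin

lemma fc_domI_AE_bounded:
  assumes g [measurable]: "g \<in> borel_measurable borel" and "AE t in spec_meas E x. \<bar>g t\<bar> \<le> K"
  shows "x \<in> fc_dom E g"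
proof -
  have "(\<integral>\<^sup>+t. ennreal ((g t)\<^sup>2) \<partial>spec_meas E x) \<le> (\<integral>\<^sup>+t. ennreal (K\<^sup>2) \<partial>spec_meas E x)"
    by (rule nn_integral_mono_AE)
       (use assms(2) in \<open>auto elim!: eventually_mono intro!: ennreal_leI power2_le_iff_abs_le[THEN iffD2] intro: order_trans[OF abs_ge_zero]\<close>)
  also have "\<dots> < \<infinity>" by (simp add: emeasure_spec_meas_UNIV ennreal_mult_less_top)
  finally show ?thesis by (simp add: fc_dom_iff_nn_integral)
qed

text \<open>The density formulas for the projection and for \<open>p\<close> put the weight
  \<open>(f \<psi>)^2\<close> on the measure of \<open>w\<close>. The choices of \<open>f\<close> as
  1, a positive and a negative power yield the three cut-off estimates.\<close>

lemma nn_integral_E_fc_rel_le: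
  assumes [measurable]: "\<psi> \<in> borel_measurable borel" "f \<in> borel_measurable borel" "C \<in> sets borel"
    and rel: "fc_rel E \<psi> w p" and bd: "\<And>t. t \<in> C \<Longrightarrow> \<bar>f t * \<psi> t\<bar> \<le> M"
  shows "(\<integral>\<^sup>+t. ennreal ((f t)\<^sup>2) \<partial>spec_meas E (E C p)) \<le> ennreal ((M * norm w)\<^sup>2)"
proof -
  have "(\<integral>\<^sup>+t. ennreal ((f t)\<^sup>2) \<partial>spec_meas E (E C p))
      = (\<integral>\<^sup>+t. indicator C t * ennreal ((f t)\<^sup>2) \<partial>spec_meas E p)"
    by (subst spec_meas_E, simp, rule nn_integral_density) auto
  also have "\<dots> = (\<integral>\<^sup>+t. ennreal ((\<psi> t)\<^sup>2) * (indicator C t * ennreal ((f t)\<^sup>2)) \<partial>spec_meas E w)"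
    unfolding spec_meas_fc_rel[OF assms(1) rel] by (rule nn_integral_density) auto
  also have "\<dots> \<le> (\<integral>\<^sup>+t. ennreal (M\<^sup>2) \<partial>spec_meas E w)"
  proof (rule nn_integral_mono)
    fix t
    show "ennreal ((\<psi> t)\<^sup>2) * (indicator C t * ennreal ((f t)\<^sup>2)) \<le> ennreal (M\<^sup>2)"
    proof (cases "t \<in> C")
      case True
      have "\<bar>f t * \<psi> t\<bar>\<^sup>2 \<le> M\<^sup>2" using bd[OF True] by (intro power_mono) auto
      then show ?thesis using True by (simp add: power_mult_distrib mult.commute flip: ennreal_mult)
    qed simp
  qed
  also have "\<dots> = ennreal ((M * norm w)\<^sup>2)"
    by (simp add: emeasure_spec_meas_UNIV power_mult_distrib ennreal_mult)
  finally show ?thesis .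
qed

end

text \<open>The spectral form of the lower bound on \<open>B\<close>; it makes powers with
  nonpositive exponent bounded almost everywhere.\<close>

locale spectral_hilbert_scale = projection_valued_measure +
  fixes m :: real
  assumes m_pos: "m > 0" and AE_ge: "AE t in spec_meas E x. m \<le> \<bar>t\<bar>"
begin

lemma AE_powr_le:
  assumes "\<tau> \<le> 0"
  shows "AE t in spec_meas E x. \<bar>t powr \<tau>\<bar> \<le> m powr \<tau>"
  using AE_ge
proof (rule eventually_mono)
  fix t assume "m \<le> \<bar>t\<bar>"
  then show "\<bar>t powr \<tau>\<bar> \<le> m powr \<tau>"
    using powr_mono2'[of \<tau> m "\<bar>t\<bar>"] assms m_pos by (simp add: powr_abs_base)
qed

text \<open>For nonpositive exponents the power is essentially bounded, so its domain is the whole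
  space. This removes the case distinction in \<open>hscale\<close>.\<close>

lemma hscale_fc_dom: "x \<in> hscale E \<tau> \<longleftrightarrow> x \<in> fc_dom E (\<lambda>t. t powr \<tau>)"
  using fc_domI_AE_bounded[OF _ AE_powr_le] by (auto simp: hscale_def)

lemma fc_rel_Bpow: "x \<in> hscale E \<tau> \<Longrightarrow> fc_rel E (\<lambda>t. t powr \<tau>) x (Bpow E \<tau> x)"
  unfolding Bpow_def by (rule fc_rel_fc) (auto simp: hscale_fc_dom)

lemma hnorm_sq:
  "x \<in> hscale E \<tau> \<Longrightarrow> ennreal ((hnorm E \<tau> x)\<^sup>2) = (\<integral>\<^sup>+t. ennreal ((t powr \<tau>)\<^sup>2) \<partial>spec_meas E x)"
  unfolding hnorm_def by (rule norm_sq_nn_integral[OF _ fc_rel_Bpow]) auto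

lemma hscale_add: "x \<in> hscale E \<tau> \<Longrightarrow> y \<in> hscale E \<tau> \<Longrightarrow> x + y \<in> hscale E \<tau>"
  and hscale_diff: "x \<in> hscale E \<tau> \<Longrightarrow> y \<in> hscale E \<tau> \<Longrightarrow> x - y \<in> hscale E \<tau>"
  unfolding hscale_fc_dom by (auto intro: fc_dom_add fc_dom_diff)

lemma hscale_nonpos: "\<tau> \<le> 0 \<Longrightarrow> x \<in> hscale E \<tau>"
  by (simp add: hscale_def)

lemma hnorm_nonneg: "hnorm E \<tau> x \<ge> 0"
  by (simp add: hnorm_def)

lemma hnorm_minus_commute:
  assumes "x - y \<in> hscale E \<tau>"
  shows "hnorm E \<tau> (x - y) = hnorm E \<tau> (y - x)"
proof -
  have "spec_meas E (y - x) = spec_meas E (x - y)" using spec_meas_uminus[of "x - y"] by simp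
  then have "ennreal ((hnorm E \<tau> (y - x))\<^sup>2) = ennreal ((hnorm E \<tau> (x - y))\<^sup>2)"
    using assms hnorm_sq[of "y - x" \<tau>] hnorm_sq[of "x - y" \<tau>]
    by (simp add: hscale_fc_dom fc_dom_def)
  then show ?thesis by (simp add: hnorm_nonneg)
qed

lemma hnorm_zero: "hnorm E \<tau> 0 = 0"
proof -
  have "0 \<in> hscale E \<tau>"
    by (simp add: hscale_fc_dom fc_dom_iff_nn_integral spec_meas_zero[OF spectral])
  from hnorm_sq[OF this] show ?thesis by (simp add: spec_meas_zero[OF spectral])
qed

lemma hnorm_add_sq_le:
  assumes "x \<in> hscale E \<tau>" "y \<in> hscale E \<tau>"
  shows "(hnorm E \<tau> (x + y))\<^sup>2 \<le> 2 * (hnorm E \<tau> x)\<^sup>2 + 2 * (hnorm E \<tau> y)\<^sup>2"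
proof -
  have "ennreal ((hnorm E \<tau> (x + y))\<^sup>2) \<le> ennreal (2 * (hnorm E \<tau> x)\<^sup>2 + 2 * (hnorm E \<tau> y)\<^sup>2)"
    using nn_integral_spec_meas_add_le[of "\<lambda>t. ennreal ((t powr \<tau>)\<^sup>2)" x y] assms
    by (simp add: hnorm_sq hscale_add ennreal_mult)
  then show ?thesis by (subst (asm) ennreal_le_iff) simp_all
qed

text \<open>Pointwise, \<open>1\<close> is dominated by the first term for \<open>\<bar>t\<bar> \<le> R\<close> and by the second for \<open>\<bar>t\<bar> \<ge> R\<close>.
  Optimising over \<open>R\<close> would give the interpolation inequality.\<close>

lemma norm_sq_le_hnorm:
  assumes x: "x \<in> hscale E 1" and R: "R > 0" and a: "a > 0"
  shows "(norm x)\<^sup>2 \<le> (R powr a * hnorm E (-a) x)\<^sup>2 + (hnorm E 1 x / R)\<^sup>2"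
proof -
  have "ennreal ((norm x)\<^sup>2) = (\<integral>\<^sup>+t. 1 \<partial>spec_meas E x)" by (simp add: emeasure_spec_meas_UNIV)
  also have "\<dots> \<le> (\<integral>\<^sup>+t. ennreal ((R powr a)\<^sup>2) * ennreal ((t powr (-a))\<^sup>2)
      + ennreal ((1 / R)\<^sup>2) * ennreal ((t powr 1)\<^sup>2) \<partial>spec_meas E x)"
  proof (rule nn_integral_mono_AE, rule eventually_mono[OF AE_ge])
    fix t assume "m \<le> \<bar>t\<bar>"
    then have t: "\<bar>t\<bar> > 0" using m_pos by linarith
    have "1 \<le> (R powr a * t powr (-a))\<^sup>2 + (1 / R * t powr 1)\<^sup>2"
    proof (cases "\<bar>t\<bar> \<le> R")
      case True
      have "\<bar>t\<bar> powr a \<le> R powr a" using True a by (intro powr_mono2) auto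
      then have "1 \<le> R powr a * t powr (-a)"
        using t by (simp add: powr_minus powr_abs_base[of t, symmetric] field_simps del: powr_abs_base)
      then have "1 \<le> (R powr a * t powr (-a))\<^sup>2" by (rule one_le_power)
      then show ?thesis using zero_le_power2[of "1 / R * t powr 1"] by linarith
    next
      case False
      have "t powr 1 = \<bar>t\<bar>" using t powr_abs_base[of t 1] by simp
      then have "1 \<le> 1 / R * t powr 1" using False R by (simp add: field_simps)
      then have "1 \<le> (1 / R * t powr 1)\<^sup>2" by (rule one_le_power)
      then show ?thesis using zero_le_power2[of "R powr a * t powr (-a)"] by linarith
    qed
    then have "ennreal 1 \<le> ennreal ((R powr a * t powr (-a))\<^sup>2 + (1 / R * t powr 1)\<^sup>2)" by (rule ennreal_leI)
    then show "1 \<le> ennreal ((R powr a)\<^sup>2) * ennreal ((t powr (-a))\<^sup>2) + ennreal ((1 / R)\<^sup>2) * ennreal ((t powr 1)\<^sup>2)"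
      by (simp only: power_mult_distrib ennreal_plus zero_le_power2 mult_nonneg_nonneg ennreal_mult ennreal_1)
  qed
  also have "\<dots> = ennreal ((R powr a)\<^sup>2) * ennreal ((hnorm E (-a) x)\<^sup>2) + ennreal ((1 / R)\<^sup>2) * ennreal ((hnorm E 1 x)\<^sup>2)"
    unfolding hnorm_sq[OF x] hnorm_sq[OF hscale_nonpos[of "-a" x], OF less_imp_le, OF neg_less_0_iff_less[THEN iffD2, OF a]]
    by (subst nn_integral_add) (auto simp: nn_integral_cmult)
  also have "\<dots> = ennreal ((R powr a * hnorm E (-a) x)\<^sup>2 + (hnorm E 1 x / R)\<^sup>2)"
    by (simp add: power_mult_distrib power_divide flip: ennreal_mult ennreal_plus)
  finally show ?thesis by (subst (asm) ennreal_le_iff) simp_all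
qed

end

section \<open>Elementary estimates for the logarithmic index function\<close>

text \<open>The function decreases for \<open>x < \<kappa> / q\<close>, so monotonicity holds only
  up to a constant depending on the distance \<open>L\<close> from the singularity at 0.\<close>

lemma powr_exp_quasi_mono:
  fixes L q \<kappa> :: real
  assumes L: "L > 0" and q: "q > 0" and \<kappa>: "\<kappa> > 0"
  shows "\<exists>C>0. \<forall>x y. L \<le> x \<longrightarrow> x \<le> y \<longrightarrow> x powr (-\<kappa>) * exp (q * x) \<le> C * (y powr (-\<kappa>) * exp (q * y))"
proof -
  \<comment> \<open>Chosen so that
    \<open>1 + (y - x) / L \<le> D * (1 + q * (y - x) / \<kappa>)\<close>, to which the exponential
    inequality applies.\<close>
  define D where "D = max 1 (\<kappa> / (q * L))"
  have D: "D \<ge> 1" "\<kappa> / (q * L) \<le> D" by (auto simp: D_def)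
  have "x powr (-\<kappa>) * exp (q * x) \<le> D powr \<kappa> * (y powr (-\<kappa>) * exp (q * y))"
    if xy: "L \<le> x" "x \<le> y" for x y
  proof -
    have pos: "x > 0" "y > 0" using xy L by auto
    have "y / x = 1 + (y - x) / x" using pos by (simp add: field_simps)
    also have "\<dots> \<le> 1 + (y - x) / L" using xy L by (intro add_left_mono divide_left_mono) auto
    also have "\<dots> = 1 + (\<kappa> / (q * L)) * (q * (y - x) / \<kappa>)" using L q \<kappa> by simp
    also have "\<dots> \<le> D + D * (q * (y - x) / \<kappa>)"
      using D xy q \<kappa> by (intro add_mono mult_right_mono) auto
    also have "\<dots> = D * (1 + q * (y - x) / \<kappa>)" by (simp add: distrib_left)
    also have "\<dots> \<le> D * exp (q * (y - x) / \<kappa>)"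
      using D(1) by (intro mult_left_mono exp_ge_add_one_self) auto
    finally have "(y / x) powr \<kappa> \<le> (D * exp (q * (y - x) / \<kappa>)) powr \<kappa>"
      using pos \<kappa> by (intro powr_mono2) auto
    also have "\<dots> = D powr \<kappa> * exp (q * (y - x))"
      using D(1) \<kappa> by (simp add: powr_mult exp_powr_real)
    finally have "y powr \<kappa> / x powr \<kappa> \<le> D powr \<kappa> * (exp (q * y) / exp (q * x))"
      using pos by (simp add: powr_divide right_diff_distrib exp_diff)
    then show ?thesis using pos by (simp add: powr_minus field_simps)
  qed
  moreover have "D powr \<kappa> > 0" using D(1) by simp
  ultimately show ?thesis by blast
qed

lemma log_powr_mono:
  fixes c \<kappa> s r :: real
  assumes "c > 0" "\<kappa> > 0" "0 < s" "s \<le> r" "c * r < 1"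
  shows "(- ln (c * s)) powr (-\<kappa>) \<le> (- ln (c * r)) powr (-\<kappa>)"
proof (rule powr_mono2')
  have "c * s \<le> c * r" "0 < c * s" using assms by auto
  then show "- ln (c * r) \<le> - ln (c * s)" by simp
  show "0 < - ln (c * r)" using \<open>0 < c * s\<close> \<open>c * s \<le> c * r\<close> assms by (simp add: ln_less_zero_iff)
qed (use assms in simp)

text \<open>The substitution \<open>x = - ln (c * s)\<close> reverses the order and turns the
  expression, up to the factor \<open>c powr q\<close>, into the function of the previous estimate;
  \<open>c * \<sigma> < 1\<close> keeps \<open>x\<close> away from 0.\<close>

lemma log_powr_quasi_antimono:
  fixes c \<kappa> q \<sigma> :: real
  assumes c: "c > 0" and \<kappa>: "\<kappa> > 0" and q: "q > 0" and \<sigma>: "\<sigma> > 0" "c * \<sigma> < 1"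
  shows "\<exists>C>0. \<forall>r s. 0 < r \<longrightarrow> r \<le> s \<longrightarrow> s \<le> \<sigma> \<longrightarrow>
    s powr (-q) * (- ln (c * s)) powr (-\<kappa>) \<le> C * (r powr (-q) * (- ln (c * r)) powr (-\<kappa>))"
proof -
  have L: "- ln (c * \<sigma>) > 0" using c \<sigma> by simp
  obtain C where C: "C > 0" "\<And>x y. - ln (c * \<sigma>) \<le> x \<Longrightarrow> x \<le> y \<Longrightarrow>
      x powr (-\<kappa>) * exp (q * x) \<le> C * (y powr (-\<kappa>) * exp (q * y))"
    using powr_exp_quasi_mono[OF L q \<kappa>] by blast
  have eq: "t powr (-q) = exp (q * (- ln (c * t))) * exp (q * ln c)" if "t > 0" for t
    using that c by (simp add: powr_def ln_mult exp_add[symmetric] algebra_simps)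
  have "s powr (-q) * (- ln (c * s)) powr (-\<kappa>) \<le> C * (r powr (-q) * (- ln (c * r)) powr (-\<kappa>))"
    if rs: "0 < r" "r \<le> s" "s \<le> \<sigma>" for r s
  proof -
    have "(- ln (c * s)) powr (-\<kappa>) * exp (q * (- ln (c * s))) \<le> C * ((- ln (c * r)) powr (-\<kappa>) * exp (q * (- ln (c * r))))"
      using rs c by (intro C(2)) auto
    from mult_right_mono[OF this, of "exp (q * ln c)"] rs show ?thesis
      by (simp add: eq mult_ac)
  qed
  then show ?thesis using C(1) by blast
qed

text \<open>The cut-off level \<open>R = (K \<phi>(\<delta>) / \<delta>)\<^sup>1\<^sup>/\<^sup>a\<close> satisfies \<open>R\<^sup>-\<^sup>b \<le> \<delta>\<close> for small \<open>\<delta>\<close>, because \<open>b / a > 2\<close>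
  and \<open>\<delta> = o(\<phi>(\<delta>)\<^sup>2)\<close>.\<close>

lemma eventually_cutoff_level:
  fixes c \<kappa> K a \<epsilon> :: real
  assumes c: "c > 0" and \<kappa>: "\<kappa> > 0" and K: "K > 0" and a: "a > 0" and \<epsilon>: "\<epsilon> > 0"
  shows "\<forall>\<^sub>F \<delta> in at_right 0. c * \<delta> < 1 \<and> (- ln (c * \<delta>)) powr (-\<kappa>) < \<epsilon> \<and>
    (\<delta> / (K * (- ln (c * \<delta>)) powr (-\<kappa>))) powr ((2 * a + 2) / a) \<le> \<delta>"
proof -
  have e1: "\<forall>\<^sub>F \<delta> in at_right 0. c * \<delta> < 1" using c by real_asymp
  have l2: "((\<lambda>\<delta>. (- ln (c * \<delta>)) powr (-\<kappa>)) \<longlongrightarrow> 0) (at_right 0)" using c \<kappa> by real_asymp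
  have l3: "((\<lambda>\<delta>. \<delta> * (- ln (c * \<delta>)) powr (2 * \<kappa>)) \<longlongrightarrow> 0) (at_right 0)" using c \<kappa> by real_asymp
  have e2: "\<forall>\<^sub>F \<delta> in at_right 0. (- ln (c * \<delta>)) powr (-\<kappa>) < \<epsilon>"
    using order_tendstoD(2)[OF l2 \<epsilon>] .
  have e3: "\<forall>\<^sub>F \<delta> in at_right 0. \<delta> * (- ln (c * \<delta>)) powr (2 * \<kappa>) < K\<^sup>2"
    using order_tendstoD(2)[OF l3] K by simp
  have e4: "\<forall>\<^sub>F \<delta>::real in at_right 0. \<delta> < 1 \<and> \<delta> > 0"
    by (auto simp: eventually_at_right_field intro: exI[of _ 1])
  from e1 e2 e3 e4 show ?thesis
  proof eventually_elim
    case (elim \<delta>)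
    define x where "x = - ln (c * \<delta>)"
    have x: "x > 0" unfolding x_def using elim c by simp
    define y where "y = \<delta> / (K * x powr (-\<kappa>))"
    have y: "y > 0" unfolding y_def using elim x K by simp
    have "y\<^sup>2 = \<delta> * (\<delta> * x powr (2 * \<kappa>)) / K\<^sup>2"
      using x by (simp add: y_def powr_minus power_divide power_mult_distrib divide_simps powr_power power2_eq_square powr_add[symmetric])
    also have "\<dots> \<le> \<delta> * K\<^sup>2 / K\<^sup>2"
      using elim by (intro divide_right_mono mult_left_mono) (auto simp: x_def)
    finally have y2: "y\<^sup>2 \<le> \<delta>" using K by simp
    have "y \<le> 1" using y2 elim y power2_le_imp_le[of y 1] by simp
    have "y powr ((2 * a + 2) / a) \<le> y powr 2"
      using y \<open>y \<le> 1\<close> a by (intro powr_mono') (auto simp: field_simps)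
    also have "\<dots> = y\<^sup>2" using y by simp
    finally show ?case using y2 elim by (simp add: x_def y_def)
  qed
qed

subsection \<open>Spectral cut-off and the discrepancy principle\<close>

text \<open>The witness is the part of \<open>p\<close> on spectral values of \<open>G\<close> at
  least \<open>r\<close>. Below \<open>r\<close> both the index function and
  \<open>s powr (a / b)\<close> are increasing; above \<open>r\<close>,
  \<open>s powr (- 1 / b)\<close> times the index function is decreasing up to a constant.\<close>

lemma spectral_cutoff_bounds:
  fixes E EG :: "real set \<Rightarrow> 'x \<Rightarrow> 'x::{real_inner, complete_space}"
  assumes "spectral_hilbert_scale E m" "projection_valued_measure EG"
    and distr: "\<And>u. spec_meas EG u = distr (spec_meas E u) borel (\<lambda>t. t powr (-b))"
    and b: "b > 0" and a: "a > 0" and c: "c > 0" and \<kappa>: "\<kappa> > 0" and \<sigma>: "\<sigma> > 0" "c * \<sigma> < 1"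
    and w: "norm w \<le> \<rho>"
    and source: "fc_rel EG (\<lambda>t. if 0 < t \<and> t \<le> \<sigma> then (- ln (c * t)) powr (- \<kappa>) else 0) w p"
  shows "\<exists>C>0. \<forall>r>0. c * r < 1 \<longrightarrow> (\<exists>q\<in>hscale E 1.
      norm (q - p) \<le> \<rho> * (- ln (c * r)) powr (-\<kappa>) \<and>
      hnorm E (-a) (q - p) \<le> \<rho> * (r powr (a / b) * (- ln (c * r)) powr (-\<kappa>)) \<and>
      hnorm E 1 q \<le> C * \<rho> * (r powr (- 1 / b) * (- ln (c * r)) powr (-\<kappa>)))"
proof -
  interpret E: spectral_hilbert_scale E m by fact
  interpret EG: projection_valued_measure EG by fact
  define \<phi> where "\<phi> s = (- ln (c * s)) powr (-\<kappa>)" for s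
  define \<psi> where "\<psi> s = (if 0 < s \<and> s \<le> \<sigma> then \<phi> s else 0)" for s
  have \<phi>0: "\<phi> s \<ge> 0" for s by (simp add: \<phi>_def)
  have meas [measurable]: "\<psi> \<in> borel_measurable borel" unfolding \<psi>_def \<phi>_def by measurable
  have "\<psi> = (\<lambda>t. if 0 < t \<and> t \<le> \<sigma> then (- ln (c * t)) powr (- \<kappa>) else 0)"
    by (auto simp: fun_eq_iff \<psi>_def \<phi>_def)
  then have rel: "fc_rel EG \<psi> w p" using source by simp
  \<comment> \<open>Since \<open>G\<close> is the power \<open>-b\<close> of the modulus of
    \<open>B\<close>, the scale norm of order \<tau> is the norm of the power
    \<open>-\<tau> / b\<close> of \<open>G\<close>.\<close>
  have transfer: "(\<integral>\<^sup>+t. ennreal ((t powr \<tau>)\<^sup>2) \<partial>spec_meas E x) = (\<integral>\<^sup>+s. ennreal ((s powr (-\<tau> / b))\<^sup>2) \<partial>spec_meas EG x)" for x \<tau>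
    using b unfolding distr by (subst nn_integral_distr) (auto simp: powr_powr)
  obtain C where C: "C > 0" "\<And>r s. 0 < r \<Longrightarrow> r \<le> s \<Longrightarrow> s \<le> \<sigma> \<Longrightarrow>
      s powr (-(1/b)) * \<phi> s \<le> C * (r powr (-(1/b)) * \<phi> r)"
    using log_powr_quasi_antimono[OF c \<kappa> _ \<sigma>, of "1/b"] b unfolding \<phi>_def by auto
  have root: "x \<le> \<rho> * M" if "ennreal (x\<^sup>2) \<le> ennreal ((M * norm w)\<^sup>2)" "M \<ge> 0" for x M
  proof -
    have "x\<^sup>2 \<le> (M * norm w)\<^sup>2" using that(1) by (simp add: ennreal_le_iff)
    then have "x \<le> M * norm w" using that(2) by (auto intro: power2_le_imp_le)
    also have "\<dots> \<le> M * \<rho>" using w that(2) by (rule mult_left_mono)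
    finally show ?thesis by (simp add: mult.commute)
  qed
  have "\<exists>q\<in>hscale E 1. norm (q - p) \<le> \<rho> * \<phi> r \<and> hnorm E (-a) (q - p) \<le> \<rho> * (r powr (a / b) * \<phi> r) \<and>
      hnorm E 1 q \<le> C * \<rho> * (r powr (- 1 / b) * \<phi> r)"
    if r: "r > 0" "c * r < 1" for r
  proof -
    have small: "\<bar>\<psi> s\<bar> \<le> \<phi> r" if "s < r" for s
      using log_powr_mono[OF c \<kappa>, of s r] r that \<phi>0[of r] by (auto simp: \<psi>_def \<phi>_def)
    have decomp: "p - EG {r..} p = EG {..<r} p"
    proof -
      have "EG ({r..} \<union> {..<r}) p = EG {r..} p + EG {..<r} p" by (rule EG.E_Un) auto
      moreover have "{r..} \<union> {..<r} = UNIV" by auto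
      ultimately show ?thesis by (simp add: EG.E_UNIV algebra_simps)
    qed
    have "ennreal ((norm (EG {..<r} p))\<^sup>2) = (\<integral>\<^sup>+s. ennreal (1\<^sup>2) \<partial>spec_meas EG (EG {..<r} p))"
      by (simp add: EG.emeasure_spec_meas_UNIV)
    also have "\<dots> \<le> ennreal ((\<phi> r * norm w)\<^sup>2)"
      by (rule EG.nn_integral_E_fc_rel_le[OF _ _ _ rel]) (use small in auto)
    finally have 1: "norm (p - EG {r..} p) \<le> \<rho> * \<phi> r" unfolding decomp by (rule root) (rule \<phi>0)
    have "ennreal ((hnorm E (-a) (EG {..<r} p))\<^sup>2) = (\<integral>\<^sup>+s. ennreal ((s powr (a / b))\<^sup>2) \<partial>spec_meas EG (EG {..<r} p))"
      using a by (subst E.hnorm_sq) (auto simp: E.hscale_nonpos transfer)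
    also have "\<dots> \<le> ennreal ((r powr (a / b) * \<phi> r * norm w)\<^sup>2)"
    proof (rule EG.nn_integral_E_fc_rel_le[OF _ _ _ rel])
      fix s assume "s \<in> {..<r}"
      then have s: "s < r" by simp
      show "\<bar>s powr (a / b) * \<psi> s\<bar> \<le> r powr (a / b) * \<phi> r"
      proof (cases "0 < s")
        case True
        have "s powr (a / b) \<le> r powr (a / b)" using True s a b by (intro powr_mono2) auto
        then show ?thesis using small[OF s] by (simp add: abs_mult mult_mono)
      qed (simp add: \<psi>_def \<phi>0)
    qed auto
    finally have 2: "hnorm E (-a) (p - EG {r..} p) \<le> \<rho> * (r powr (a / b) * \<phi> r)"
      unfolding decomp by (rule root) (simp add: \<phi>0)
    have le: "(\<integral>\<^sup>+t. ennreal ((t powr 1)\<^sup>2) \<partial>spec_meas E (EG {r..} p)) \<le> ennreal ((C * (r powr (- (1 / b)) * \<phi> r) * norm w)\<^sup>2)"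
      unfolding transfer
    proof (rule EG.nn_integral_E_fc_rel_le[OF _ _ _ rel])
      fix s assume "s \<in> {r..}"
      then show "\<bar>s powr (- 1 / b) * \<psi> s\<bar> \<le> C * (r powr (- (1 / b)) * \<phi> r)"
        using C(2)[of r s] C(1) r \<phi>0[of s] \<phi>0[of r] by (auto simp: \<psi>_def abs_mult)
    qed auto
    \<comment> \<open>The same estimate first shows membership in the domain and then, below, bounds
      the norm.\<close>
    then have "EG {r..} p \<in> fc_dom E (\<lambda>t. t powr 1)"
      by (subst E.fc_dom_iff_nn_integral) (auto intro: le_less_trans)
    then have 3: "EG {r..} p \<in> hscale E 1" by (simp add: E.hscale_fc_dom)
    have "hnorm E 1 (EG {r..} p) \<le> \<rho> * (C * (r powr (- (1 / b)) * \<phi> r))"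
      using C(1) \<phi>0 by (intro root) (use le E.hnorm_sq[OF 3] in auto)
    then show ?thesis
      using 1 2 3 E.hnorm_minus_commute[of "EG {r..} p" p "-a"] E.hscale_nonpos[of "-a"] a
      by (intro bexI[OF _ 3]) (simp add: norm_minus_commute mult_ac)
  qed
  then show ?thesis unfolding \<phi>_def using C(1) by blast
qed

text \<open>The residual of \<open>v\<close> lies strictly below \<open>k * \<delta>\<close>.
  Comparison with \<open>v\<close> at \<gamma> therefore bounds the penalty parameter from below,
  and comparison at \<alpha> absorbs the squared noise level into the penalty of
  \<open>v\<close>.\<close>

lemma (in spectral_hilbert_scale) discrepancy_hnorm_le:
  assumes k: "k > 1" and l: "l > 1" and \<delta>: "\<delta> > 0"
    and sel: "discrepancy_selected E DF F ubar k l \<delta> fd u"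
    and ubar: "ubar \<in> DF \<inter> hscale E 1" and v: "v \<in> DF \<inter> hscale E 1"
    and Fv: "norm (F v - fd) \<le> (k + 1) / 2 * \<delta>"
  shows "u \<in> DF \<inter> hscale E 1" "norm (F u - fd) \<le> k * \<delta>"
    "(hnorm E 1 (u - ubar))\<^sup>2
       \<le> (1 + ((k + 1) / 2)\<^sup>2 * l / (k\<^sup>2 - ((k + 1) / 2)\<^sup>2)) * (hnorm E 1 (v - ubar))\<^sup>2"
proof -
  define h where "h = hnorm E 1 (v - ubar)"
  define j where "j = (k + 1) / 2"
  define d where "d = k\<^sup>2 - j\<^sup>2"
  have "j < k" "j > 0" using k by (auto simp: j_def)
  then have d: "d > 0" by (simp add: d_def power_strict_mono)
  have Fv2: "(norm (F v - fd))\<^sup>2 \<le> j\<^sup>2 * \<delta>\<^sup>2"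
    using power_mono[OF Fv norm_ge_zero, of 2] by (simp only: j_def flip: power_mult_distrib)
  \<comment> \<open>The functional is finite at \<open>v\<close>, so a minimizer cannot take the
    value infinity and lies in \<open>hscale E 1\<close>.\<close>
  have minim: "z \<in> DF \<inter> hscale E 1 \<and> (norm (F z - fd))\<^sup>2 + \<beta> * (hnorm E 1 (z - ubar))\<^sup>2 \<le> j\<^sup>2 * \<delta>\<^sup>2 + \<beta> * h\<^sup>2"
    if "tikhonov_minimizer E DF F ubar fd \<beta> z" for \<beta> z
  proof -
    have "z \<in> DF" "tikhonov E F ubar fd \<beta> z \<le> tikhonov E F ubar fd \<beta> v"
      using that v by (auto simp: tikhonov_minimizer_def)
    then have "z \<in> hscale E 1"
      "(norm (F z - fd))\<^sup>2 + \<beta> * (hnorm E 1 (z - ubar))\<^sup>2 \<le> (norm (F v - fd))\<^sup>2 + \<beta> * h\<^sup>2"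
      using v by (auto simp: tikhonov_def h_def split: if_splits)
    then show ?thesis using Fv2 \<open>z \<in> DF\<close> by auto
  qed
  have "u \<in> DF \<inter> hscale E 1 \<and> norm (F u - fd) \<le> k * \<delta> \<and> (hnorm E 1 (u - ubar))\<^sup>2 \<le> (1 + j\<^sup>2 * l / d) * h\<^sup>2"
    using sel unfolding discrepancy_selected_def
  proof (elim disjE conjE exE)
    assume "norm (F ubar - fd) \<le> k * \<delta>" "u = ubar"
    moreover have "0 \<le> (1 + j\<^sup>2 * l / d) * h\<^sup>2" using d l by simp
    ultimately show ?thesis using ubar by (simp add: hnorm_zero)
  next
    fix \<alpha> \<gamma> z
    assume \<alpha>: "0 < \<alpha>" and u: "tikhonov_minimizer E DF F ubar fd \<alpha> u" "norm (F u - fd) \<le> k * \<delta>"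
      and \<gamma>: "\<alpha> \<le> \<gamma>" "\<gamma> \<le> l * \<alpha>" and z: "tikhonov_minimizer E DF F ubar fd \<gamma> z" "k * \<delta> \<le> norm (F z - fd)"
    have "(k * \<delta>)\<^sup>2 \<le> (norm (F z - fd))\<^sup>2" using z(2) k \<delta> by (intro power_mono) auto
    also have "\<dots> \<le> j\<^sup>2 * \<delta>\<^sup>2 + \<gamma> * h\<^sup>2"
    proof -
      have "0 \<le> \<gamma> * (hnorm E 1 (z - ubar))\<^sup>2" using \<alpha> \<gamma> by simp
      then show ?thesis using minim[OF z(1)] by linarith
    qed
    also have "\<gamma> * h\<^sup>2 \<le> l * \<alpha> * h\<^sup>2" using \<gamma> by (intro mult_right_mono) auto
    finally have "\<delta>\<^sup>2 * d \<le> l * \<alpha> * h\<^sup>2" by (simp add: d_def power_mult_distrib algebra_simps)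
    \<comment> \<open>The lower bound on \<alpha>, written without dividing by \<open>h\<close>,
      which might vanish.\<close>
    then have \<delta>_le: "\<delta>\<^sup>2 \<le> l * \<alpha> * h\<^sup>2 / d" using d by (simp add: pos_le_divide_eq)
    have "\<alpha> * (hnorm E 1 (u - ubar))\<^sup>2 \<le> j\<^sup>2 * \<delta>\<^sup>2 + \<alpha> * h\<^sup>2"
      using minim[OF u(1)] zero_le_power2[of "norm (F u - fd)"] by linarith
    also have "\<dots> \<le> j\<^sup>2 * (l * \<alpha> * h\<^sup>2 / d) + \<alpha> * h\<^sup>2"
      using \<delta>_le by (intro add_right_mono mult_left_mono) auto
    also have "\<dots> = \<alpha> * ((1 + j\<^sup>2 * l / d) * h\<^sup>2)" by (simp add: algebra_simps)
    finally have "(hnorm E 1 (u - ubar))\<^sup>2 \<le> (1 + j\<^sup>2 * l / d) * h\<^sup>2" using \<alpha> by simp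
    then show ?thesis using minim[OF u(1)] u(2) by blast
  qed
  then show "u \<in> DF \<inter> hscale E 1" "norm (F u - fd) \<le> k * \<delta>"
    "(hnorm E 1 (u - ubar))\<^sup>2
       \<le> (1 + ((k + 1) / 2)\<^sup>2 * l / (k\<^sup>2 - ((k + 1) / 2)\<^sup>2)) * (hnorm E 1 (v - ubar))\<^sup>2"
    by (auto simp: h_def d_def j_def)
qed

section \<open>The logarithmic convergence rate\<close>

theorem theorem5p1:
  fixes DB :: "'x::{real_inner, complete_space} set" and B :: "'x \<Rightarrow> 'x"
    and E :: "real set \<Rightarrow> 'x \<Rightarrow> 'x" and EG :: "real set \<Rightarrow> 'x \<Rightarrow> 'x"
    and F :: "'x \<Rightarrow> 'y::{real_inner, complete_space}" and DF :: "'x set"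
    and udag ubar w :: 'x and fdag :: 'y
    and m a ca Ca \<kappa> c \<rho> k l :: real
  assumes infX: "infinite_dimensional TYPE('x)"
    and infY: "infinite_dimensional TYPE('y)"
    \<comment> \<open>B: densely defined, selfadjoint, unbounded, \<parallel>Bu\<parallel> \<ge> m\<parallel>u\<parallel>; E its spectral resolution\<close>
    and B_sa: "selfadjoint_op DB B"
    and B_unbdd: "\<not> (\<exists>C. \<forall>u\<in>DB. norm (B u) \<le> C * norm u)"
    and m_pos: "m > 0" and B_below: "\<forall>u\<in>DB. norm (B u) \<ge> m * norm u"
    and E_B: "spectral_resolution_of E DB B"
    \<comment> \<open>Assumption A\<close>
    and A_a: "\<forall>s u. (\<forall>n. s n \<in> DF) \<longrightarrow> u \<in> DF \<longrightarrow> weakly_conv s u \<longrightarrow> weakly_conv (F \<circ> s) (F u)"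
    and A_b: "closed DF" "convex DF"
    and A_c: "DF \<inter> hscale E 1 \<noteq> {}" "ubar \<in> DF \<inter> hscale E 1"
    and A_d: "udag \<in> interior DF"
    and Fud: "F udag = fdag"
    and A_f: "a > 0" "0 < ca" "ca \<le> Ca"
       "\<forall>u\<in>DF \<inter> hscale E 1. ca * hnorm E (-a) (u - udag) \<le> norm (F u - fdag)
                              \<and> norm (F u - fdag) \<le> Ca * hnorm E (-a) (u - udag)"
    \<comment> \<open>source condition; G = B^{-(2a+2)}, EG its spectral resolution\<close>
    and EG_G: "spectral_resolution_of EG UNIV (Bpow E (-(2*a+2)))"
    and kappa_pos: "\<kappa> > 0"
    and c_range: "0 < c" "c < 1 / onorm (Bpow E (-(2*a+2)))"
    and rho_pos: "\<rho> > 0" and w_bd: "norm w \<le> \<rho>"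
    and source: "fc_rel EG
        (\<lambda>t. if 0 < t \<and> t \<le> onorm (Bpow E (-(2*a+2))) then (- ln (c * t)) powr (- \<kappa>) else 0)
        w (udag - ubar)"
    \<comment> \<open>discrepancy principle constants\<close>
    and kl: "k > 1" "l > 1"
  shows "\<exists>C \<delta>0. \<delta>0 > 0 \<and>
    (\<forall>\<delta> fd u. 0 < \<delta> \<and> \<delta> < \<delta>0 \<and> norm (fd - fdag) \<le> \<delta>
        \<and> discrepancy_selected E DF F ubar k l \<delta> fd u
        \<longrightarrow> norm (u - udag) \<le> C * (- ln (c * \<delta>)) powr (- \<kappa>))"
proof -
  have res: "DB = fc_dom E (\<lambda>t. t)" "\<And>u. u \<in> DB \<Longrightarrow> fc_rel E (\<lambda>t. t) u (B u)"
    using E_B by (auto simp: spectral_resolution_of_def)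
  interpret E: projection_valued_measure E
    using B_sa B_unbdd E_B by (rule selfadjoint_spectral_resolution_additive)
  have AE_ge: "AE t in spec_meas E x. m \<le> \<bar>t\<bar>" for x
    by (rule E.AE_spec_meas_ge[of B]) (use res B_below m_pos in auto)
  interpret E: spectral_hilbert_scale E m
    by unfold_locales (rule m_pos, rule AE_ge)
  define b where "b = 2 * a + 2"
  have b: "b > 0" using A_f(1) by (simp add: b_def)
  define G where "G = Bpow E (-b)"
  have G: "fc_rel E (\<lambda>t. t powr (-b)) u (G u)" for u
    unfolding G_def using b by (intro E.fc_rel_Bpow E.hscale_nonpos) simp
  \<comment> \<open>The form is the integral of a function that is positive almost everywhere, over
    a measure with nonzero mass. This definiteness gives additivity of \<open>EG\<close>.\<close>
  have G_pos: "inner (G u) u \<noteq> 0" if "u \<noteq> 0" for u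
  proof
    assume "inner (G u) u = 0"
    then have "(\<integral>t. t powr (-b) \<partial>spec_meas E u) = 0"
      using E.inner_fc_rel[OF _ G] by simp
    moreover have "integrable (spec_meas E u) (\<lambda>t. t powr (-b))"
      using G[of u] by (intro E.integrable_fc_dom) (auto simp: fc_rel_def)
    ultimately have "AE t in spec_meas E u. t powr (-b) = 0"
      by (subst (asm) integral_nonneg_eq_0_iff_AE) auto
    with AE_ge[of u] have "AE t in spec_meas E u. False"
      by eventually_elim (use m_pos in auto)
    then have "emeasure (spec_meas E u) UNIV = 0"
      using AE_iff_measurable[of UNIV "spec_meas E u" "\<lambda>_. False"] by simp
    then show False using that by (simp add: E.emeasure_spec_meas_UNIV)
  qed
  have EG: "spectral_resolution_of EG UNIV G" using EG_G by (simp add: G_def b_def)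
  interpret EG: projection_valued_measure EG
    using EG G_pos by (rule definite_spectral_resolution_additive)
  have distr: "spec_meas EG u = distr (spec_meas E u) borel (\<lambda>t. t powr (-b))" for u
  proof (rule spec_meas_eq_distr)
    show "AE t in spec_meas E u. \<bar>t powr (-b)\<bar> \<le> m powr (-b)" for u
      using b by (intro E.AE_powr_le) simp
    show "fc_rel EG (\<lambda>t. t) u (G u)" for u using EG by (simp add: spectral_resolution_of_def)
  qed (use G in \<open>auto intro: E.projection_valued_measure_axioms EG.projection_valued_measure_axioms\<close>)
  define \<sigma> where "\<sigma> = onorm G"
  have c\<sigma>: "c < 1 / \<sigma>" using c_range(2) by (simp add: \<sigma>_def G_def b_def)
  \<comment> \<open>As \<open>1 / 0 = 0\<close>, the condition \<open>0 < c < 1 / \<sigma>\<close>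
    also excludes a vanishing operator norm.\<close>
  then have \<sigma>: "\<sigma> > 0" using c_range(1) by (metis less_trans zero_less_divide_1_iff)
  have c\<sigma>: "c * \<sigma> < 1" using c\<sigma> \<sigma> by (simp add: field_simps)
  define \<phi> where "\<phi> s = (- ln (c * s)) powr (-\<kappa>)" for s
  have "fc_rel EG (\<lambda>t. if 0 < t \<and> t \<le> \<sigma> then (- ln (c * t)) powr (- \<kappa>) else 0) w (udag - ubar)"
    using source by (simp add: \<sigma>_def G_def b_def)
  from spectral_cutoff_bounds[OF E.spectral_hilbert_scale_axioms EG.projection_valued_measure_axioms
      distr b A_f(1) c_range(1) kappa_pos \<sigma> c\<sigma> w_bd this]
  obtain C where C: "C > 0" and cutoff: "\<And>r. r > 0 \<Longrightarrow> c * r < 1 \<Longrightarrow> \<exists>q\<in>hscale E 1.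
      norm (q - (udag - ubar)) \<le> \<rho> * \<phi> r \<and>
      hnorm E (-a) (q - (udag - ubar)) \<le> \<rho> * (r powr (a / b) * \<phi> r) \<and>
      hnorm E 1 q \<le> C * \<rho> * (r powr (- 1 / b) * \<phi> r)"
    unfolding \<phi>_def by blast
  obtain \<epsilon> where \<epsilon>: "\<epsilon> > 0" "ball udag \<epsilon> \<subseteq> DF" using A_d mem_interior by blast
  \<comment> \<open>Makes the noise-free residual of \<open>v\<close> at most
    \<open>(k - 1) / 2 * \<delta>\<close>, leaving half of the slack between \<open>\<delta>\<close>
    and \<open>k * \<delta>\<close>.\<close>
  define K where "K = 2 * Ca * \<rho> / (k - 1)"
  have Ca: "Ca > 0" using A_f by simp
  have K: "K > 0" using Ca rho_pos kl by (simp add: K_def)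
  define A where "A = 1 + ((k + 1) / 2)\<^sup>2 * l / (k\<^sup>2 - ((k + 1) / 2)\<^sup>2)"
  \<comment> \<open>The two summands collect the contributions of the norms of order
    \<open>-a\<close> and 1 to the squared norm of \<open>u - v\<close>, both in units of the
    squared rate.\<close>
  define D where "D = K\<^sup>2 * (2 * ((k + 1) / ca)\<^sup>2 + 2 * (\<rho> / K)\<^sup>2) + (2 * A + 2) * (C * \<rho>)\<^sup>2"
  have A0: "A \<ge> 0"
  proof -
    have "((k + 1) / 2)\<^sup>2 \<le> k\<^sup>2" using kl by (intro power_mono) auto
    then show ?thesis using kl by (simp add: A_def)
  qed
  then have D0: "D \<ge> 0" by (simp add: D_def)
  have main: "norm (u - udag) \<le> (sqrt D + \<rho>) * \<phi> \<delta>"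
    if \<delta>: "\<delta> > 0" "c * \<delta> < 1" "\<phi> \<delta> < \<epsilon> / \<rho>" "(\<delta> / (K * \<phi> \<delta>)) powr (b / a) \<le> \<delta>"
      and fd: "norm (fd - fdag) \<le> \<delta>" and sel: "discrepancy_selected E DF F ubar k l \<delta> fd u"
    for \<delta> fd u
  proof -
    define f where "f = \<phi> \<delta>"
    have "c * \<delta> > 0" using c_range \<delta> by simp
    then have f: "f > 0" using \<delta>(2) by (simp add: f_def \<phi>_def)
    \<comment> \<open>This level balances \<open>R powr a * \<delta>\<close> against
      \<open>(R * f) / R\<close>: both terms of the norm splitting become of order
      \<open>f\<close>.\<close>
    define R where "R = (K * f / \<delta>) powr (1 / a)"
    define r where "r = R powr (-b)"
    have R: "R > 0" using K f \<delta>(1) by (simp add: R_def)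
    have r: "r > 0" using R by (simp add: r_def)
    have Ra: "R powr a = K * f / \<delta>" using K f \<delta>(1) A_f(1) by (simp add: R_def powr_powr)
    have "r = (\<delta> / (K * f)) powr (b / a)"
      using K f \<delta>(1) by (simp add: r_def R_def powr_powr powr_minus powr_divide)
    then have r\<delta>: "r \<le> \<delta>" using \<delta>(4) by (simp add: f_def)
    then have cr: "c * r < 1" using \<delta>(2) c_range(1) mult_left_mono[OF r\<delta>, of c] by linarith
    have \<phi>r: "\<phi> r \<le> f"
      unfolding f_def \<phi>_def by (rule log_powr_mono[OF c_range(1) kappa_pos r r\<delta> \<delta>(2)])
    have "r powr (a / b) = R powr (-a)" using b by (simp add: r_def powr_powr)
    then have ra: "r powr (a / b) = \<delta> / (K * f)" using Ra by (simp add: powr_minus)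
    have r1: "r powr (- 1 / b) = R" using b R by (simp add: r_def powr_powr)
    obtain q where q: "q \<in> hscale E 1" and q1: "norm (q - (udag - ubar)) \<le> \<rho> * \<phi> r"
      and q2: "hnorm E (-a) (q - (udag - ubar)) \<le> \<rho> * (r powr (a / b) * \<phi> r)"
      and q3: "hnorm E 1 q \<le> C * \<rho> * (r powr (- 1 / b) * \<phi> r)"
      using cutoff[OF r cr] by blast
    define v where "v = ubar + q"
    have v_udag: "q - (udag - ubar) = v - udag" and v_ubar: "q = v - ubar" by (simp_all add: v_def)
    have v1: "norm (v - udag) \<le> \<rho> * f"
      using q1 mult_left_mono[OF \<phi>r less_imp_le[OF rho_pos]] unfolding v_udag by (rule order_trans)
    have v2: "hnorm E (-a) (v - udag) \<le> \<rho> * \<delta> / K"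
    proof -
      have "hnorm E (-a) (v - udag) \<le> \<rho> * (\<delta> / (K * f) * \<phi> r)" using q2 unfolding v_udag ra .
      also have "\<dots> \<le> \<rho> * (\<delta> / (K * f) * f)"
        using \<phi>r rho_pos \<delta>(1) K f by (intro mult_left_mono) auto
      finally show ?thesis using f by simp
    qed
    have v3: "hnorm E 1 (v - ubar) \<le> C * \<rho> * (R * f)"
    proof -
      have "hnorm E 1 (v - ubar) \<le> C * \<rho> * (R * \<phi> r)" using q3 unfolding v_ubar r1 .
      also have "\<dots> \<le> C * \<rho> * (R * f)" using \<phi>r rho_pos C R by (intro mult_left_mono) auto
      finally show ?thesis .
    qed
    have v: "v \<in> DF \<inter> hscale E 1"
    proof
      \<comment> \<open>Here the interior point assumption enters: a small rate keeps
        \<open>v\<close> in a ball inside \<open>DF\<close>, so it may compete in the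
        minimization.\<close>
      have "\<rho> * f < \<epsilon>" using \<delta>(3) rho_pos by (simp add: f_def field_simps)
      then have "v \<in> ball udag \<epsilon>" using v1 by (simp add: dist_norm norm_minus_commute)
      then show "v \<in> DF" using \<epsilon>(2) by blast
      show "v \<in> hscale E 1" unfolding v_def using A_c(2) q by (intro E.hscale_add) auto
    qed
    have "norm (F v - fdag) \<le> Ca * hnorm E (-a) (v - udag)" using A_f(4) v by blast
    also have "\<dots> \<le> Ca * (\<rho> * \<delta> / K)" using v2 Ca by (intro mult_left_mono) auto
    also have "\<dots> = (k - 1) / 2 * \<delta>" using Ca rho_pos kl by (simp add: K_def)
    finally have Fv: "norm (F v - fd) \<le> (k + 1) / 2 * \<delta>"
      using fd norm_triangle_ineq[of "F v - fdag" "fdag - fd"] by (simp add: norm_minus_commute field_simps)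
    note disc = E.discrepancy_hnorm_le[OF kl \<delta>(1) sel A_c(2) v Fv, folded A_def]
    have "ca * hnorm E (-a) (u - udag) \<le> norm (F u - fdag)" using A_f(4) disc(1) by blast
    also have "\<dots> \<le> (k + 1) * \<delta>"
      using fd disc(2) norm_triangle_ineq[of "F u - fd" "fd - fdag"] by (simp add: field_simps)
    finally have u2: "hnorm E (-a) (u - udag) \<le> (k + 1) / ca * \<delta>"
      using A_f(2) by (simp add: field_simps)
    have neg: "x \<in> hscale E (-a)" for x using A_f(1) by (simp add: E.hscale_nonpos)
    have na: "(hnorm E (-a) (u - v))\<^sup>2 \<le> (2 * ((k + 1) / ca)\<^sup>2 + 2 * (\<rho> / K)\<^sup>2) * \<delta>\<^sup>2"
    proof -
      have "(hnorm E (-a) (u - v))\<^sup>2 \<le> 2 * (hnorm E (-a) (u - udag))\<^sup>2 + 2 * (hnorm E (-a) (v - udag))\<^sup>2"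
        using E.hnorm_add_sq_le[OF neg neg, of "u - udag" "udag - v"] E.hnorm_minus_commute[OF neg, of udag v]
        by simp
      also have "\<dots> \<le> 2 * ((k + 1) / ca * \<delta>)\<^sup>2 + 2 * (\<rho> * \<delta> / K)\<^sup>2"
        using u2 v2 by (intro add_mono mult_left_mono power_mono) (auto simp: E.hnorm_nonneg)
      also have "2 * (x * \<delta>)\<^sup>2 + 2 * (\<rho> * \<delta> / K)\<^sup>2 = (2 * x\<^sup>2 + 2 * (\<rho> / K)\<^sup>2) * \<delta>\<^sup>2" for x
        by (simp add: power2_eq_square algebra_simps)
      finally show ?thesis .
    qed
    have n1: "(hnorm E 1 (u - v))\<^sup>2 \<le> (2 * A + 2) * (C * \<rho> * (R * f))\<^sup>2"
    proof -
      have dom: "u - ubar \<in> hscale E 1" "ubar - v \<in> hscale E 1"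
        using disc(1) v A_c(2) by (auto intro: E.hscale_diff)
      have "(hnorm E 1 (u - v))\<^sup>2 \<le> 2 * (hnorm E 1 (u - ubar))\<^sup>2 + 2 * (hnorm E 1 (v - ubar))\<^sup>2"
        using E.hnorm_add_sq_le[OF dom] E.hnorm_minus_commute[OF dom(2)] by simp
      also have "\<dots> \<le> (2 * A + 2) * (hnorm E 1 (v - ubar))\<^sup>2"
        using disc(3) by (simp add: algebra_simps)
      also have "\<dots> \<le> (2 * A + 2) * (C * \<rho> * (R * f))\<^sup>2"
        using v3 A0 by (intro mult_left_mono power_mono) (auto simp: E.hnorm_nonneg)
      finally show ?thesis .
    qed
    \<comment> \<open>The splitting is applied to \<open>u - v\<close> because \<open>udag\<close>
      itself need not lie in \<open>hscale E 1\<close>; the remaining \<open>v - udag\<close> is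
      already of the order of the rate.\<close>
    have "(norm (u - v))\<^sup>2 \<le> (R powr a * hnorm E (-a) (u - v))\<^sup>2 + (hnorm E 1 (u - v) / R)\<^sup>2"
      using disc(1) v R A_f(1) by (intro E.norm_sq_le_hnorm E.hscale_diff) auto
    also have "\<dots> = (K * f / \<delta>)\<^sup>2 * (hnorm E (-a) (u - v))\<^sup>2 + (hnorm E 1 (u - v))\<^sup>2 / R\<^sup>2"
      by (simp add: Ra power_mult_distrib power_divide)
    also have "\<dots> \<le> (K * f / \<delta>)\<^sup>2 * ((2 * ((k + 1) / ca)\<^sup>2 + 2 * (\<rho> / K)\<^sup>2) * \<delta>\<^sup>2)
        + (2 * A + 2) * (C * \<rho> * (R * f))\<^sup>2 / R\<^sup>2"
      using na n1 by (intro add_mono mult_left_mono divide_right_mono) auto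
    also have "\<dots> = D * f\<^sup>2"
    proof -
      have e1: "(K * f / \<delta>)\<^sup>2 * (X * \<delta>\<^sup>2) = K\<^sup>2 * X * f\<^sup>2" for X
        using \<delta>(1) by (simp add: power_divide power_mult_distrib)
      have e2: "X * (C * \<rho> * (R * f))\<^sup>2 / R\<^sup>2 = X * (C * \<rho>)\<^sup>2 * f\<^sup>2" for X
        using R by (simp add: power_mult_distrib)
      show ?thesis unfolding D_def e1 e2 by (rule distrib_right[symmetric])
    qed
    finally have "(norm (u - v))\<^sup>2 \<le> (sqrt D * f)\<^sup>2" using D0 by (simp add: power_mult_distrib)
    then have "norm (u - v) \<le> sqrt D * f" using f D0 by (auto intro: power2_le_imp_le)
    then have "norm (u - udag) \<le> sqrt D * f + \<rho> * f"
      using v1 norm_triangle_ineq[of "u - v" "v - udag"] by simp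
    then show ?thesis by (simp add: f_def distrib_right)
  qed
  \<comment> \<open>The threshold \<open>\<epsilon> / \<rho>\<close> is the one that keeps
    \<open>v\<close> in the ball around \<open>udag\<close>.\<close>
  have "\<forall>\<^sub>F \<delta> in at_right 0. c * \<delta> < 1 \<and> \<phi> \<delta> < \<epsilon> / \<rho> \<and> (\<delta> / (K * \<phi> \<delta>)) powr (b / a) \<le> \<delta>"
    unfolding \<phi>_def b_def using \<epsilon>(1) rho_pos
    by (intro eventually_cutoff_level c_range(1) kappa_pos K A_f(1)) simp
  then obtain \<delta>0 where "\<delta>0 > 0" and \<delta>0: "\<And>\<delta>. 0 < \<delta> \<Longrightarrow> \<delta> < \<delta>0 \<Longrightarrow>
      c * \<delta> < 1 \<and> \<phi> \<delta> < \<epsilon> / \<rho> \<and> (\<delta> / (K * \<phi> \<delta>)) powr (b / a) \<le> \<delta>"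
    by (auto simp: eventually_at_right_field)
  show ?thesis
  proof (intro exI conjI allI impI)
    show "\<delta>0 > 0" by fact
    fix \<delta> fd u
    assume *: "0 < \<delta> \<and> \<delta> < \<delta>0 \<and> norm (fd - fdag) \<le> \<delta>
      \<and> discrepancy_selected E DF F ubar k l \<delta> fd u"
    then have "norm (u - udag) \<le> (sqrt D + \<rho>) * \<phi> \<delta>"
      using \<delta>0[of \<delta>] by (intro main) auto
    then show "norm (u - udag) \<le> (sqrt D + \<rho>) * (- ln (c * \<delta>)) powr (- \<kappa>)"
      by (simp only: \<phi>_def)
  qed
qed

end
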